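(* Fix $r\in(0,\infty)$ and a parameter sequence $\theta_\infty$ with first $n$ coordinates $\theta_n\in\mathbb{R}^n$, and put $a_n=n^{-1}\|\theta_n\|^2$. If $\|\theta_n\|^2\to\infty$ as $n\to\infty$, then [a] $\rho\big(\theta_n,N(X_n,(1+r)I_n)\big)=\frac n2\log(1+r^{-1})$; [b] $\rho\big(\theta_n,N(\widehat\theta_n^{JS},rI_n)\big)\sim\frac{n}{2r}\,\frac{a_n}{1+a_n}$; [c] $\rho\big(\theta_n,N(\widehat\theta_n^{JS},(1+r)I_n)\big)\sim\frac n2\big\{\log(1+r^{-1})-(1+a_n)^{-1}(1+r)^{-1}\big\}$; [d] $\rho\big(\theta_n,g[\widehat\theta_n^{JS}]\big)\sim\frac n2\log\Big\{1+r^{-1}\,\frac{a_n}{1+a_n}\Big\}$.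
   Context: The observed past is $X_n\sim N(\theta_n,I_n)$ and the future is $Y_n\sim N(\theta_n,rI_n)$, independent of $X_n$. A predictive density estimate $\widehat p(\cdot|X_n)$ has Kullback-Leibler predictive risk $\rho(\theta_n,\widehat p)=\mathbb{E}_{\theta_n}\int p_{\theta_n}(y)\log\frac{p_{\theta_n}(y)}{\widehat p(y|X_n)}\,dy$, where $p_{\theta_n}$ is the $N(\theta_n,rI_n)$ density and $\mathbb{E}_{\theta_n}$ is over $X_n\sim N(\theta_n,I_n)$. $N(\mu(X_n),\Sigma)$ as an argument of $\rho$ denotes the predictive density estimate equal to the Gaussian density with that (data-dependent) mean and covariance. The James-Stein estimator is $\widehat\theta_n^{JS}=X_n\big(1-\frac{n-2}{\|X_n\|^2}\big)$, and $g[\widehat\theta_n^{JS}]$ is the density of $N(\widehat\theta_n^{JS},\widehat c_n\,r\,I_n)$ with $\widehat c_n=1+(nr)^{-1}\widehat U_n^{+}$, $\widehat U_n^{+}=\max\big\{n-\frac{(n-2)^2}{\|X_n\|^2},0\big\}$. For sequences, $u_n\sim v_n$ means $u_n=v_n(1+o(1))$ as $n\to\infty$. *)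

theory Defs
  imports "HOL-Probability.Probability" "HOL-Library.Landau_Symbols"
begin

text \<open>The dimension \<open>n\<close> tends to infinity, so a vector of \<open>\<real>\<^sup>n\<close> is a function \<open>nat \<Rightarrow> real\<close> of
  which only the values at \<open>i < n\<close> are used (coordinates are numbered from 0). In particular the
  truncation \<open>\<theta>\<^sub>n\<close> of a sequence \<open>\<theta>\<close> is \<open>\<theta>\<close> itself, used in dimension \<open>n\<close>.\<close>

abbreviation vnorm :: "nat \<Rightarrow> (nat \<Rightarrow> real) \<Rightarrow> real" where
  "vnorm n x \<equiv> L2_set x {..<n}"

abbreviation lborel_n :: "nat \<Rightarrow> (nat \<Rightarrow> real) measure" where
  "lborel_n n \<equiv> Pi\<^sub>M {..<n} (\<lambda>_. lborel)"

text \<open>The density of \<open>N(\<mu>, v I\<^sub>n)\<close>; \<open>v\<close> is the variance, whereas \<open>normal_density\<close> expects the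
  standard deviation.\<close>

definition normal_density_n :: "nat \<Rightarrow> (nat \<Rightarrow> real) \<Rightarrow> real \<Rightarrow> (nat \<Rightarrow> real) \<Rightarrow> real" where
  "normal_density_n n \<mu> v y = (\<Prod>i<n. normal_density (\<mu> i) (sqrt v) (y i))"

lemma normal_density_n_eq:
  assumes "v > 0"
  shows "normal_density_n n \<mu> v y =
    (2 * pi * v) powr (- (real n / 2)) * exp (- (vnorm n (\<lambda>i. y i - \<mu> i))\<^sup>2 / (2 * v))"
proof -
  have p: "2 * pi * v > 0" using assms by simp
  have sv: "(sqrt v)\<^sup>2 = v" using assms by simp
  have "normal_density_n n \<mu> v y =
      (\<Prod>i<n. (1 / sqrt (2 * pi * v)) * exp (- (y i - \<mu> i)\<^sup>2 / (2 * v)))"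
    unfolding normal_density_n_def normal_density_def sv ..
  also have "\<dots> = (1 / sqrt (2 * pi * v)) ^ n * exp (\<Sum>i<n. - (y i - \<mu> i)\<^sup>2 / (2 * v))"
    by (simp only: prod.distrib prod_constant card_lessThan exp_sum [OF finite_lessThan])
  also have "(1 / sqrt (2 * pi * v)) ^ n = (2 * pi * v) powr (- (real n / 2))"
  proof -
    have "1 / sqrt (2 * pi * v) = (2 * pi * v) powr (- (1 / 2))"
      using powr_half_sqrt [OF less_imp_le [OF p]] powr_minus_divide [of "2 * pi * v" "1 / 2"]
      by (simp only:)
    moreover have "((2 * pi * v) powr (- (1 / 2))) ^ n = (2 * pi * v) powr (- (1 / 2) * real n)"
      using p by (simp only: powr_realpow [symmetric] powr_gt_zero powr_powr less_imp_neq [symmetric] simp_thms)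
    moreover have "- (1 / 2) * real n = - (real n / 2)" by linarith
    ultimately show ?thesis by (simp only:)
  qed
  also have "(\<Sum>i<n. - (y i - \<mu> i)\<^sup>2 / (2 * v)) = - (\<Sum>i<n. (y i - \<mu> i)\<^sup>2) / (2 * v)"
    by (simp only: sum_negf sum_divide_distrib [symmetric])
  also have "(\<Sum>i<n. (y i - \<mu> i)\<^sup>2) = (vnorm n (\<lambda>i. y i - \<mu> i))\<^sup>2"
    unfolding L2_set_def by (rule real_sqrt_pow2 [symmetric]) (intro sum_nonneg zero_le_power2)
  finally show ?thesis .
qed

definition normal_law_n :: "nat \<Rightarrow> (nat \<Rightarrow> real) \<Rightarrow> real \<Rightarrow> (nat \<Rightarrow> real) measure" where
  "normal_law_n n \<mu> v = density (lborel_n n) (\<lambda>x. ennreal (normal_density_n n \<mu> v x))"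

text \<open>\<open>phat x y\<close> stands for the predictive density estimate \<open>p\<close>-hat\<open>(y | x)\<close>. The integrals are
  Bochner integrals, hence \<open>0\<close> where the integrand is not integrable. A Gaussian
  \<open>phat x\<close> always has an integrable inner integrand.\<close>

definition predictive_risk ::
    "nat \<Rightarrow> real \<Rightarrow> (nat \<Rightarrow> real) \<Rightarrow> ((nat \<Rightarrow> real) \<Rightarrow> (nat \<Rightarrow> real) \<Rightarrow> real) \<Rightarrow> real" where
  "predictive_risk n r \<theta> phat =
    (\<integral>x. (\<integral>y. normal_density_n n \<theta> r y * ln (normal_density_n n \<theta> r y / phat x y) \<partial>lborel_n n)
      \<partial>normal_law_n n \<theta> 1)"

definition james_stein :: "nat \<Rightarrow> (nat \<Rightarrow> real) \<Rightarrow> nat \<Rightarrow> real" where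
  "james_stein n x = (\<lambda>i. x i * (1 - (real n - 2) / (vnorm n x)\<^sup>2))"

definition U_hat_pos :: "nat \<Rightarrow> (nat \<Rightarrow> real) \<Rightarrow> real" where
  "U_hat_pos n x = max (real n - (real n - 2)\<^sup>2 / (vnorm n x)\<^sup>2) 0"

definition c_hat :: "nat \<Rightarrow> real \<Rightarrow> (nat \<Rightarrow> real) \<Rightarrow> real" where
  "c_hat n r x = 1 + U_hat_pos n x / (real n * r)"

definition g_james_stein :: "nat \<Rightarrow> real \<Rightarrow> (nat \<Rightarrow> real) \<Rightarrow> (nat \<Rightarrow> real) \<Rightarrow> real" where
  "g_james_stein n r x = normal_density_n n (james_stein n x) (c_hat n r x * r)"

definition mean_square :: "(nat \<Rightarrow> real) \<Rightarrow> nat \<Rightarrow> real" where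
  "mean_square \<theta> n = (vnorm n \<theta>)\<^sup>2 / real n"

end

theory Submission
  imports Defs "HOL-Real_Asymp.Real_Asymp"
begin

text \<open>The divergence between \<open>N(\<theta>, r I)\<close> and \<open>N(\<mu>, v I)\<close> is explicit, so every risk is an expectation of
  a function of \<open>S = \<parallel>X\<parallel>\<^sup>2\<close> and of the James-Stein loss \<open>L\<close>. Put \<open>M = n + \<parallel>\<theta>\<parallel>\<^sup>2\<close> and
  \<open>D = \<parallel>\<theta>\<parallel>\<^sup>2 / M = a\<^sub>n / (1 + a\<^sub>n)\<close>. Writing \<open>1 / S\<close> as the integral of \<open>exp (- t S)\<close> over \<open>t > 0\<close> and
  tilting the Gaussian gives Stein's formula \<open>E L = n - (n - 2)\<^sup>2 E (1 / S)\<close> together with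
  \<open>1 / M \<le> E (1 / S) \<le> 1 / (M - 4)\<close> and \<open>E (1 / S\<^sup>2) \<le> 1 / (M - 8)\<^sup>2\<close>; hence \<open>E L\<close> differs from \<open>n D\<close> by at
  most 4. For the estimated variance \<open>r + u\<close>, replacing \<open>u\<close> by \<open>D\<close> changes the risk only to second
  order, that is by \<open>O(1)\<close>. Since \<open>n D\<close> tends to infinity, bounded errors do not affect the
  asymptotics.\<close>

subsection \<open>Gaussian product laws and their divergence\<close>

text \<open>Only \<parallel>\<theta>\<parallel>^2 \<rightarrow> \<infinity> is assumed, so a_n may
  tend to 0 and \<open>n D\<close> may grow arbitrarily slowly. A law-of-large-numbers argument
  leaves errors of order sqrt n and could not decide [b] or [d]; the expectations must be known up
  to O(1). For [b] and [c] the risk is affine in the loss, so the two-sided bound on E (1 / S)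
  suffices. In [d] the variance estimate enters nonlinearly and is correlated with the loss. What
  saves the argument is that \<open>r + D\<close> minimises the divergence over the variance when
  the loss equals \<open>n D\<close>: first-order errors vanish, and the remaining products have
  bounded expectation, since \<open>u - D\<close> is of order sqrt n / M + 1 / n and
  \<open>L - n D\<close> of order sqrt n. The inverse moments rest on a family of functions of t
  that is closed under differentiation: every integral over t is evaluated or bounded through an
  explicit antiderivative, and this replaces Stein's integration by parts in R^n.\<close>

lemma vnorm_sq: "(vnorm n x)\<^sup>2 = (\<Sum>i<n. (x i)\<^sup>2)"
  unfolding L2_set_def by (rule real_sqrt_pow2) (simp add: sum_nonneg)

lemma measurable_vnorm [measurable]:
  "(\<lambda>x. vnorm n (\<lambda>i. x i - \<mu> i)) \<in> borel_measurable (lborel_n n)"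
  "vnorm n \<in> borel_measurable (lborel_n n)"
  unfolding L2_set_def by measurable

lemma normal_density_n_pos: "v > 0 \<Longrightarrow> normal_density_n n \<mu> v y > 0"
  by (simp add: normal_density_n_def normal_density_pos prod_pos)

lemma measurable_normal_density_n [measurable]:
  "normal_density_n n \<mu> v \<in> borel_measurable (lborel_n n)"
  unfolding normal_density_n_def by measurable

text \<open>Independence of the coordinates. The law is defined by a density, whereas products of
  one-coordinate integrals and null sets of one coordinate are available for product measures; the
  two agree on boxes.\<close>

lemma normal_law_n_eq_PiM:
  "normal_law_n n \<mu> v = Pi\<^sub>M {..<n} (\<lambda>i. density lborel (normal_density (\<mu> i) (sqrt v)))"
  (is "_ = Pi\<^sub>M _ ?N")
  if "v > 0"
proof (rule product_sigma_finite.PiM_eqI)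
  have pr: "prob_space (?N i)" for i
    using that by (intro prob_space_normal_density) simp
  show "product_sigma_finite ?N"
    using pr by (simp add: product_sigma_finite_def prob_space_imp_sigma_finite)
  show "sets (normal_law_n n \<mu> v) = sets (Pi\<^sub>M {..<n} ?N)"
    unfolding normal_law_n_def by (simp cong: sets_PiM_cong)
  fix A assume A: "\<And>i. i \<in> {..<n} \<Longrightarrow> A i \<in> sets (?N i)"
  then have A': "i < n \<Longrightarrow> A i \<in> sets borel" for i by simp
  interpret product_sigma_finite "\<lambda>_::nat. lborel :: real measure"
    by standard
  have B: "Pi\<^sub>E {..<n} A \<in> sets (lborel_n n)"
    using A' by (intro sets_PiM_I_finite) auto
  have "emeasure (normal_law_n n \<mu> v) (Pi\<^sub>E {..<n} A) =
      (\<integral>\<^sup>+x. ennreal (normal_density_n n \<mu> v x) * indicator (Pi\<^sub>E {..<n} A) x \<partial>lborel_n n)"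
    unfolding normal_law_n_def using B by (subst emeasure_density) auto
  also have "\<dots> = (\<integral>\<^sup>+x. (\<Prod>i<n. ennreal (normal_density (\<mu> i) (sqrt v) (x i)) * indicator (A i) (x i)) \<partial>lborel_n n)"
  proof (intro nn_integral_cong)
    fix x :: "nat \<Rightarrow> real" assume "x \<in> space (lborel_n n)"
    \<comment> \<open>Membership in a \<open>Pi\<^sub>E\<close> box also fixes the values outside
      \<open>{..<n}\<close>, which no factor of the product tests; points of the space satisfy this
      already.\<close>
    then have "x \<in> extensional {..<n}" by (auto simp: space_PiM PiE_def)
    then have "indicator (Pi\<^sub>E {..<n} A) x = (\<Prod>i<n. indicator (A i) (x i) :: ennreal)"
      by (auto simp: indicator_def PiE_def Pi_def prod_zero_iff split: if_splits)
    then show "ennreal (normal_density_n n \<mu> v x) * indicator (Pi\<^sub>E {..<n} A) x =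
        (\<Prod>i<n. ennreal (normal_density (\<mu> i) (sqrt v) (x i)) * indicator (A i) (x i))"
      by (simp add: normal_density_n_def prod.distrib prod_ennreal)
  qed
  also have "\<dots> = (\<Prod>i<n. \<integral>\<^sup>+x. ennreal (normal_density (\<mu> i) (sqrt v) x) * indicator (A i) x \<partial>lborel)"
    using A' by (intro product_nn_integral_prod) auto
  also have "\<dots> = (\<Prod>i<n. emeasure (?N i) (A i))"
    using A' by (intro prod.cong refl) (subst emeasure_density, auto)
  finally show "emeasure (normal_law_n n \<mu> v) (Pi\<^sub>E {..<n} A) = (\<Prod>i<n. emeasure (?N i) (A i))" .
qed simp

lemma prob_space_normal_law_n: "v > 0 \<Longrightarrow> prob_space (normal_law_n n \<mu> v)"
  by (simp add: normal_law_n_eq_PiM prob_space_PiM prob_space_normal_density)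

lemma sets_normal_law_n [measurable_cong, simp]: "sets (normal_law_n n \<mu> v) = sets (lborel_n n)"
  by (simp add: normal_law_n_def)

lemma has_bochner_integral_normal_law_n_prod:
  fixes f :: "nat \<Rightarrow> real \<Rightarrow> real"
  assumes v: "v > 0"
    and f: "\<And>i. i < n \<Longrightarrow> has_bochner_integral (density lborel (normal_density (\<mu> i) (sqrt v))) (f i) (c i)"
  shows "has_bochner_integral (normal_law_n n \<mu> v) (\<lambda>x. \<Prod>i<n. f i (x i)) (\<Prod>i<n. c i)"
proof -
  interpret product_sigma_finite "\<lambda>i. density lborel (normal_density (\<mu> i) (sqrt v))"
    using v by (simp add: product_sigma_finite_def prob_space_imp_sigma_finite prob_space_normal_density)
  have "integrable (density lborel (normal_density (\<mu> i) (sqrt v))) (f i)" if "i < n" for i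
    using f[OF that] by (rule integrable.intros)
  moreover have "integral\<^sup>L (density lborel (normal_density (\<mu> i) (sqrt v))) (f i) = c i" if "i < n" for i
    using f[OF that] by (rule has_bochner_integral_integral_eq)
  ultimately show ?thesis
    unfolding normal_law_n_eq_PiM[OF v] has_bochner_integral_iff
    by (subst product_integral_prod) (auto intro!: product_integrable_prod)
qed

lemma normal_law_moments:
  fixes \<mu> v :: real
  assumes v: "v > 0"
  defines "N \<equiv> density lborel (normal_density \<mu> (sqrt v))"
  shows "has_bochner_integral N (\<lambda>x. 1) (1::real)"
    and "has_bochner_integral N (\<lambda>x. x - \<mu>) 0"
    and "has_bochner_integral N (\<lambda>x. (x - \<mu>)^2) v"
    and "has_bochner_integral N (\<lambda>x. (x - \<mu>)^4) (3 * v\<^sup>2)"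
proof -
  have *: "has_bochner_integral N f y"
    if "has_bochner_integral lborel (\<lambda>x. normal_density \<mu> (sqrt v) x * f x) y" "f \<in> borel_measurable borel"
    for f :: "real \<Rightarrow> real" and y
    unfolding N_def using that by (intro has_bochner_integral_density) auto
  have s: "sqrt v > 0" using v by simp
  show "has_bochner_integral N (\<lambda>x. 1) (1::real)"
    using normal_moment_even[OF s, of \<mu> 0] by (intro *) auto
  show "has_bochner_integral N (\<lambda>x. x - \<mu>) 0"
    using normal_moment_odd[OF s, of \<mu> 0] by (intro *) auto
  show "has_bochner_integral N (\<lambda>x. (x - \<mu>)^2) v"
    using normal_moment_even[OF s, of \<mu> 1] v by (intro *) auto
  have [simp]: "fact 4 = (24::real)" by (simp add: fact_numeral)
  show "has_bochner_integral N (\<lambda>x. (x - \<mu>)^4) (3 * v\<^sup>2)"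
    using normal_moment_even[OF s, of \<mu> 2] v
    by (intro *) (auto simp: power2_eq_square field_simps)
qed

lemma has_bochner_integral_normal_law_n_coord:
  fixes f :: "real \<Rightarrow> real"
  assumes v: "v > 0" and i: "i < n"
    and f: "has_bochner_integral (density lborel (normal_density (\<mu> i) (sqrt v))) f c"
  shows "has_bochner_integral (normal_law_n n \<mu> v) (\<lambda>x. f (x i)) c"
proof -
  have "has_bochner_integral (normal_law_n n \<mu> v)
      (\<lambda>x. \<Prod>k<n. (if k = i then f else (\<lambda>_. 1)) (x k)) (\<Prod>k<n. if k = i then c else 1)"
    using f normal_law_moments(1)[OF v]
    by (intro has_bochner_integral_normal_law_n_prod[OF v]) auto
  moreover have "(\<Prod>k<n. (if k = i then f else (\<lambda>_. 1)) (x k)) = f (x i)" for x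
    using i by (subst prod.cong[OF refl, of _ _ "\<lambda>k. if k = i then f (x k) else 1"]) auto
  ultimately show ?thesis using i by simp
qed

text \<open>Bias-variance decomposition in each coordinate. The free centre \<open>\<nu>\<close>
  serves the divergence (centre at the estimate), \<open>S\<close> (centre 0) and \<open>Q\<close>
  under a tilted law, whose mean is not \<theta>.\<close>

lemma expectation_sq_dist:
  assumes v: "v > 0"
  shows "has_bochner_integral (normal_law_n n \<mu> v) (\<lambda>x. (vnorm n (\<lambda>i. x i - \<nu> i))\<^sup>2)
    (real n * v + (vnorm n (\<lambda>i. \<mu> i - \<nu> i))\<^sup>2)"
proof -
  have 1: "has_bochner_integral (density lborel (normal_density (\<mu> i) (sqrt v)))
      (\<lambda>x. (x - \<mu> i)^2 + 2 * (\<mu> i - \<nu> i) * (x - \<mu> i) + (\<mu> i - \<nu> i)^2 * 1)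
      (v + 2 * (\<mu> i - \<nu> i) * 0 + (\<mu> i - \<nu> i)^2 * 1)" for i
    by (intro has_bochner_integral_add has_bochner_integral_mult_right normal_law_moments v)
  have "has_bochner_integral (density lborel (normal_density (\<mu> i) (sqrt v)))
      (\<lambda>x. (x - \<nu> i)^2) (v + (\<mu> i - \<nu> i)^2)" for i
    by (rule has_bochner_integral_cong[THEN iffD1, OF refl _ _ 1])
      (auto simp: power2_eq_square algebra_simps)
  then have "has_bochner_integral (normal_law_n n \<mu> v) (\<lambda>x. \<Sum>i<n. (x i - \<nu> i)^2)
      (\<Sum>i<n. v + (\<mu> i - \<nu> i)^2)"
    by (intro has_bochner_integral_sum has_bochner_integral_normal_law_n_coord[OF v,
        where f = "\<lambda>x. (x - _)^2"]) auto
  then show ?thesis by (simp add: vnorm_sq sum.distrib)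
qed

text \<open>The variance of a chi-square variable. The centred summands are independent, so mixed
  products have mean 0 and each diagonal term contributes 3 - 2 + 1 = 2.\<close>

lemma expectation_sq_dist_deviation:
  "has_bochner_integral (normal_law_n n \<mu> 1)
     (\<lambda>x. ((vnorm n (\<lambda>i. x i - \<mu> i))\<^sup>2 - real n)\<^sup>2) (2 * real n)"
proof -
  let ?N = "\<lambda>i. density lborel (normal_density (\<mu> i) (sqrt 1))"
  define g where "g i x = (x - \<mu> i)^2 - 1" for i x
  have g1: "has_bochner_integral (?N i) (g i) 0" for i
    using has_bochner_integral_diff[OF normal_law_moments(3,1)[of 1 "\<mu> i"]] by (simp add: g_def[abs_def])
  have "has_bochner_integral (?N i) (\<lambda>x. (x - \<mu> i)^4 - 2 * (x - \<mu> i)^2 + 1) (3 * 1\<^sup>2 - 2 * 1 + 1)" for i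
    by (intro has_bochner_integral_add has_bochner_integral_diff has_bochner_integral_mult_right
        normal_law_moments zero_less_one)
  then have g2: "has_bochner_integral (?N i) (\<lambda>x. g i x * g i x) 2" for i
    by (rule has_bochner_integral_cong[THEN iffD1, rotated -1])
      (auto simp: g_def power2_eq_square power4_eq_xxxx algebra_simps)
  have one: "has_bochner_integral (?N i) (\<lambda>x. 1) (1::real)" for i
    by (intro normal_law_moments) simp
  have ij: "has_bochner_integral (normal_law_n n \<mu> 1) (\<lambda>x. g i (x i) * g j (x j)) (if i = j then 2 else 0)"
    if "i < n" "j < n" for i j
  proof (cases "i = j")
    case True
    then show ?thesis
      using has_bochner_integral_normal_law_n_coord[OF _ that(1) g2] by simp
  next
    case False
    have "has_bochner_integral (normal_law_n n \<mu> 1)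
        (\<lambda>x. \<Prod>k<n. (if k = i \<or> k = j then g k else (\<lambda>_. 1)) (x k)) (\<Prod>k<n. if k = i \<or> k = j then 0 else 1)"
      using g1 one by (intro has_bochner_integral_normal_law_n_prod) auto
    moreover have "(\<Prod>k<n. (if k = i \<or> k = j then g k else (\<lambda>_. 1)) (x k)) = g i (x i) * g j (x j)" for x
    proof -
      have "(\<Prod>k<n. (if k = i \<or> k = j then g k else (\<lambda>_. 1)) (x k)) =
          (\<Prod>k<n. (if k = i then g k (x k) else 1) * (if k = j then g k (x k) else 1))"
        using False by (intro prod.cong) auto
      then show ?thesis using that by (simp add: prod.distrib)
    qed
    moreover have "(\<Prod>k<n. if k = i \<or> k = j then 0 else 1) = (0::real)"
      using that by (auto simp: prod_zero_iff)
    ultimately show ?thesis using False by simp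
  qed
  have "has_bochner_integral (normal_law_n n \<mu> 1) (\<lambda>x. \<Sum>i<n. \<Sum>j<n. g i (x i) * g j (x j))
      (\<Sum>i<n. \<Sum>j<n. if i = j then 2 else 0)"
    by (intro has_bochner_integral_sum ij) auto
  moreover have "(\<Sum>i<n. \<Sum>j<n. g i (x i) * g j (x j)) = ((vnorm n (\<lambda>i. x i - \<mu> i))\<^sup>2 - real n)\<^sup>2" for x
  proof -
    have "(\<Sum>i<n. \<Sum>j<n. g i (x i) * g j (x j)) = (\<Sum>i<n. g i (x i))\<^sup>2"
      by (simp add: power2_eq_square sum_product)
    also have "(\<Sum>i<n. g i (x i)) = (vnorm n (\<lambda>i. x i - \<mu> i))\<^sup>2 - real n"
      by (simp add: g_def vnorm_sq sum_subtractf)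
    finally show ?thesis .
  qed
  ultimately show ?thesis by (simp add: mult.commute)
qed

lemma ln_normal_density_n_ratio:
  assumes "r > 0" "v > 0"
  shows "ln (normal_density_n n \<theta> r y / normal_density_n n \<mu> v y) =
    real n / 2 * ln (v / r) - (vnorm n (\<lambda>i. y i - \<theta> i))\<^sup>2 / (2 * r) + (vnorm n (\<lambda>i. y i - \<mu> i))\<^sup>2 / (2 * v)"
proof -
  have p: "normal_density_n n \<theta> r y > 0" "normal_density_n n \<mu> v y > 0"
    using assms by (auto intro: normal_density_n_pos)
  have l: "ln (normal_density_n n \<mu> v y) =
      - (real n / 2) * ln (2 * pi * v) - (vnorm n (\<lambda>i. y i - \<mu> i))\<^sup>2 / (2 * v)"
    if "v > 0" for v \<mu>
    using that by (simp add: normal_density_n_eq ln_mult ln_powr)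
  show ?thesis
    using assms p by (simp add: ln_div l ln_mult field_simps)
qed

text \<open>The logarithm of the ratio is quadratic in \<open>y\<close>, so second moments suffice.
  Here \<open>\<mu>\<close> and \<open>v\<close> are fixed; in the risks the formula is applied at
  each \<open>x\<close> to their data-dependent values.\<close>

lemma kl_normal_density_n:
  assumes r: "r > 0" and v: "v > 0"
  shows "(\<integral>y. normal_density_n n \<theta> r y * ln (normal_density_n n \<theta> r y / normal_density_n n \<mu> v y) \<partial>lborel_n n) =
    1 / 2 * (real n * ln (v / r) - real n + real n * r / v + (vnorm n (\<lambda>i. \<mu> i - \<theta> i))\<^sup>2 / v)"
proof -
  interpret prob_space "normal_law_n n \<theta> r" by (rule prob_space_normal_law_n[OF r])
  have c: "has_bochner_integral (normal_law_n n \<theta> r) (\<lambda>_. real n / 2 * ln (v / r)) (real n / 2 * ln (v / r))"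
    by (simp add: has_bochner_integral_iff prob_space)
  have "(\<integral>y. normal_density_n n \<theta> r y * ln (normal_density_n n \<theta> r y / normal_density_n n \<mu> v y) \<partial>lborel_n n) =
      (\<integral>y. normal_density_n n \<theta> r y * (real n / 2 * ln (v / r) - (vnorm n (\<lambda>i. y i - \<theta> i))\<^sup>2 / (2 * r) +
         (vnorm n (\<lambda>i. y i - \<mu> i))\<^sup>2 / (2 * v)) \<partial>lborel_n n)"
    by (simp only: ln_normal_density_n_ratio[OF r v])
  also have "\<dots> = (\<integral>y. (real n / 2 * ln (v / r) - (vnorm n (\<lambda>i. y i - \<theta> i))\<^sup>2 / (2 * r) +
         (vnorm n (\<lambda>i. y i - \<mu> i))\<^sup>2 / (2 * v)) \<partial>normal_law_n n \<theta> r)"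
    unfolding normal_law_n_def using r
    by (subst integral_density) (auto simp: normal_density_n_pos less_imp_le)
  also have "\<dots> = real n / 2 * ln (v / r) - (real n * r + (vnorm n (\<lambda>i. \<theta> i - \<theta> i))\<^sup>2) / (2 * r) +
      (real n * r + (vnorm n (\<lambda>i. \<theta> i - \<mu> i))\<^sup>2) / (2 * v)"
    by (intro has_bochner_integral_integral_eq has_bochner_integral_add has_bochner_integral_diff
        has_bochner_integral_divide c expectation_sq_dist r)
  also have "(vnorm n (\<lambda>i. \<theta> i - \<mu> i))\<^sup>2 = (vnorm n (\<lambda>i. \<mu> i - \<theta> i))\<^sup>2"
    by (simp add: vnorm_sq power2_commute)
  finally show ?thesis
    using r v by (simp add: vnorm_sq field_simps)
qed

subsection \<open>Inverse moments of the squared norm\<close>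

text \<open>With \<open>\<kappa> = \<parallel>\<theta>\<parallel>\<^sup>2\<close> and \<open>a = - n / 2\<close> this is the total mass left when \<open>N(\<theta>, I\<^sub>n)\<close> is multiplied by
  \<open>exp (- t \<parallel>x\<parallel>\<^sup>2)\<close>. The other exponents provide antiderivatives.\<close>

definition tilt_weight :: "real \<Rightarrow> real \<Rightarrow> real \<Rightarrow> real" where
  "tilt_weight \<kappa> a t = (1 + 2 * t) powr a * exp (- (\<kappa> * t / (1 + 2 * t)))"

lemma measurable_tilt_weight [measurable]: "tilt_weight \<kappa> a \<in> borel_measurable borel"
  unfolding tilt_weight_def by measurable

lemma tilt_weight_nonneg [simp]: "0 \<le> tilt_weight \<kappa> a t"
  by (simp add: tilt_weight_def)

lemma tilt_weight_0 [simp]: "tilt_weight \<kappa> a 0 = 1"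
  by (simp add: tilt_weight_def)

lemma tilt_weight_mono: "t \<ge> 0 \<Longrightarrow> a \<le> b \<Longrightarrow> tilt_weight \<kappa> a t \<le> tilt_weight \<kappa> b t"
  unfolding tilt_weight_def by (intro mult_right_mono powr_mono) auto

lemma tilt_weight_diff_1: "t \<ge> 0 \<Longrightarrow> tilt_weight \<kappa> (a - 1) t = tilt_weight \<kappa> a t / (1 + 2 * t)"
  unfolding tilt_weight_def by (simp add: powr_diff)

lemma tilt_weight_diff_2: "t \<ge> 0 \<Longrightarrow> tilt_weight \<kappa> (a - 2) t = tilt_weight \<kappa> a t / (1 + 2 * t)\<^sup>2"
  unfolding tilt_weight_def by (simp add: powr_diff)

text \<open>Since \<open>\<kappa> * t / (1 + 2 * t)\<close> has derivative
  \<open>\<kappa> / (1 + 2 * t)^2\<close>, differentiation only lowers the exponent by 1 or 2 and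
  stays within the family.\<close>

lemma DERIV_tilt_weight:
  assumes "t \<ge> 0"
  shows "(tilt_weight \<kappa> a has_real_derivative
    2 * a * tilt_weight \<kappa> (a - 1) t - \<kappa> * tilt_weight \<kappa> (a - 2) t) (at t)"
proof -
  have "(tilt_weight \<kappa> a has_real_derivative
      (a * (1 + 2 * t) powr (a - 1) * 2) * exp (- (\<kappa> * t / (1 + 2 * t))) +
      (1 + 2 * t) powr a * (exp (- (\<kappa> * t / (1 + 2 * t))) *
        - ((\<kappa> * (1 + 2 * t) - \<kappa> * t * 2) / ((1 + 2 * t) * (1 + 2 * t))))) (at t)"
    unfolding tilt_weight_def[abs_def] using assms
    by (auto intro!: derivative_eq_intros simp: powr_diff)
  also have "\<kappa> * (1 + 2 * t) - \<kappa> * t * 2 = \<kappa>" by (simp add: algebra_simps)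
  finally have D: "(tilt_weight \<kappa> a has_real_derivative
      (a * (1 + 2 * t) powr (a - 1) * 2) * exp (- (\<kappa> * t / (1 + 2 * t))) +
      (1 + 2 * t) powr a * (exp (- (\<kappa> * t / (1 + 2 * t))) *
        - (\<kappa> / ((1 + 2 * t) * (1 + 2 * t))))) (at t)" .
  have "(1 + 2 * t) powr (a - 2) = (1 + 2 * t) powr a / ((1 + 2 * t) * (1 + 2 * t))"
    using assms by (simp add: powr_diff power2_eq_square)
  then show ?thesis
    by (intro DERIV_cong[OF D]) (simp add: tilt_weight_def)
qed

lemma tendsto_tilt_weight:
  assumes "\<kappa> \<ge> 0" "a < 0"
  shows "(tilt_weight \<kappa> a \<longlongrightarrow> 0) at_top"
proof (rule tendsto_sandwich[OF _ _ tendsto_const])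
  show "((\<lambda>t. (1 + 2 * t) powr a) \<longlongrightarrow> 0) at_top"
    using assms(2) by real_asymp
  show "\<forall>\<^sub>F t in at_top. tilt_weight \<kappa> a t \<le> (1 + 2 * t) powr a"
    using eventually_ge_at_top[of 0]
  proof eventually_elim
    case (elim t)
    then have "exp (- (\<kappa> * t / (1 + 2 * t))) \<le> 1" using assms(1) by simp
    then show ?case unfolding tilt_weight_def
      by (intro mult_left_le) auto
  qed
qed auto

lemma tendsto_times_tilt_weight:
  assumes "\<kappa> \<ge> 0" "a < - 1"
  shows "((\<lambda>t. t * tilt_weight \<kappa> a t) \<longlongrightarrow> 0) at_top"
proof (rule tendsto_sandwich[OF _ _ tendsto_const tendsto_tilt_weight[of \<kappa> "a + 1"]])
  show "\<forall>\<^sub>F t in at_top. 0 \<le> t * tilt_weight \<kappa> a t"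
    using eventually_ge_at_top[of 0] by eventually_elim simp
  show "\<forall>\<^sub>F t in at_top. t * tilt_weight \<kappa> a t \<le> tilt_weight \<kappa> (a + 1) t"
    using eventually_ge_at_top[of 0]
  proof eventually_elim
    case (elim t)
    then have "tilt_weight \<kappa> (a + 1) t = (1 + 2 * t) * tilt_weight \<kappa> a t"
      by (simp add: tilt_weight_def powr_add)
    then show ?case using elim by (simp add: mult_right_mono)
  qed
qed (use assms in auto)

text \<open>With \<open>a = 2 - n / 2\<close> the derivative of
  \<open>- tilt_weight \<kappa> a\<close> is \<kappa> times the integrand plus \<open>n - 4\<close>
  times a weight of larger exponent. It dominates \<open>B\<close> times the integrand, and its
  total mass is 1.\<close>

lemma nn_integral_tilt_weight_le:
  fixes n :: nat
  assumes n: "n \<ge> 5" and \<kappa>: "\<kappa> \<ge> 0"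
  shows "(\<integral>\<^sup>+t. ennreal (tilt_weight \<kappa> (- (real n / 2)) t) * indicator {0..} t \<partial>lborel)
    \<le> ennreal (1 / (real n - 4 + \<kappa>))"
proof -
  define a where "a = 2 - real n / 2"
  define B where "B = real n - 4 + \<kappa>"
  have B: "B > 0" using n \<kappa> by (simp add: B_def)
  let ?f = "\<lambda>t. - (1 / B) * (2 * a * tilt_weight \<kappa> (a - 1) t - \<kappa> * tilt_weight \<kappa> (a - 2) t)"
  have ge: "tilt_weight \<kappa> (- (real n / 2)) t \<le> ?f t" if "t \<ge> 0" for t
  proof -
    have "B * tilt_weight \<kappa> (a - 2) t \<le> - (2 * a) * tilt_weight \<kappa> (a - 1) t + \<kappa> * tilt_weight \<kappa> (a - 2) t"
      using mult_left_mono[OF tilt_weight_mono[OF that, of "a - 2" "a - 1" \<kappa>], of "- (2 * a)"] n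
      by (simp add: a_def B_def algebra_simps)
    then show ?thesis using B by (simp add: a_def field_simps)
  qed
  have "(\<integral>\<^sup>+t. ennreal (tilt_weight \<kappa> (- (real n / 2)) t) * indicator {0..} t \<partial>lborel)
      \<le> (\<integral>\<^sup>+t. ennreal (?f t) * indicator {0..} t \<partial>lborel)"
    using ge by (intro nn_integral_mono) (auto intro!: ennreal_leI split: split_indicator)
  also have "\<dots> = ennreal (- (1 / B) * 0 - - (1 / B) * tilt_weight \<kappa> a 0)"
  proof (rule nn_integral_FTC_atLeast)
    show "DERIV (\<lambda>t. - (1 / B) * tilt_weight \<kappa> a t) t :> ?f t" if "0 \<le> t" for t
      by (rule DERIV_cmult[OF DERIV_tilt_weight[OF that]])
    show "0 \<le> ?f t" if "0 \<le> t" for t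
      using ge[OF that] tilt_weight_nonneg order_trans by blast
    show "((\<lambda>t. - (1 / B) * tilt_weight \<kappa> a t) \<longlongrightarrow> - (1 / B) * 0) at_top"
      using n \<kappa> by (intro tendsto_mult_left tendsto_tilt_weight) (auto simp: a_def)
  qed measurable
  finally show ?thesis by (simp add: B_def)
qed

text \<open>The antiderivative is \<open>- (W a + B * t * W (a - 2)) / B^2\<close> with
  \<open>a = 4 - n / 2\<close>. The product rule leaves an unwanted \<open>B * W (a - 2)\<close>,
  which the derivative of \<open>- W a\<close> outweighs; this forces the shift by 8 in
  \<open>B\<close>.\<close>

lemma nn_integral_times_tilt_weight_le:
  fixes n :: nat
  assumes n: "n \<ge> 9" and \<kappa>: "\<kappa> \<ge> 0"
  shows "(\<integral>\<^sup>+t. ennreal (t * tilt_weight \<kappa> (- (real n / 2)) t) * indicator {0..} t \<partial>lborel)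
    \<le> ennreal (1 / (real n - 8 + \<kappa>)\<^sup>2)"
proof -
  define a where "a = 4 - real n / 2"
  define B where "B = real n - 8 + \<kappa>"
  have B: "B > 0" using n \<kappa> by (simp add: B_def)
  define W where "W = tilt_weight \<kappa>"
  \<comment> \<open>Left unsimplified, in the shape in which \<open>DERIV_mult'\<close> and
    \<open>DERIV_cmult\<close> deliver the derivative.\<close>
  let ?f = "\<lambda>t. - (1 / B\<^sup>2) * ((2 * a * W (a - 1) t - \<kappa> * W (a - 2) t) +
     (B * t * (2 * (a - 2) * W (a - 2 - 1) t - \<kappa> * W (a - 2 - 2) t) + B * 1 * W (a - 2) t))"
  have ge: "t * W (- (real n / 2)) t \<le> ?f t" if t: "t \<ge> 0" for t
  proof -
    have "B * W (a - 2) t \<le> - (2 * a) * W (a - 1) t + \<kappa> * W (a - 2) t"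
      using mult_left_mono[OF tilt_weight_mono[OF that, of "a - 2" "a - 1" \<kappa>], of "- (2 * a)"] n
      by (simp add: a_def B_def W_def algebra_simps)
    moreover have "B * W (a - 4) t \<le> - (2 * (a - 2)) * W (a - 3) t + \<kappa> * W (a - 4) t"
    proof -
      have "- (2 * (a - 2)) * W (a - 4) t \<le> - (2 * (a - 2)) * W (a - 3) t"
        unfolding W_def using n t by (intro mult_left_mono tilt_weight_mono) (auto simp: a_def)
      \<comment> \<open>At exponent \<open>a - 2\<close> the coefficient is \<open>n - 4\<close>,
        whereas \<open>B\<close> contains only \<open>n - 8\<close>; the surplus is dropped.\<close>
      moreover have "0 \<le> 4 * W (a - 4) t" by (simp add: W_def)
      moreover have "B * W (a - 4) t = - (2 * (a - 2)) * W (a - 4) t + \<kappa> * W (a - 4) t - 4 * W (a - 4) t"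
        by (simp add: a_def B_def algebra_simps)
      ultimately show ?thesis by linarith
    qed
    then have "B * t * (B * W (a - 4) t) \<le> B * t * (- (2 * (a - 2)) * W (a - 3) t + \<kappa> * W (a - 4) t)"
      using t B by (intro mult_left_mono) auto
    ultimately have *: "B\<^sup>2 * (t * W (a - 4) t) \<le> B\<^sup>2 * ?f t"
      using B by (simp add: power2_eq_square algebra_simps)
    have "t * W (a - 4) t \<le> ?f t"
      by (rule mult_left_le_imp_le[OF *]) (use B in simp)
    moreover have "a - 4 = - (real n / 2)" by (simp add: a_def)
    ultimately show ?thesis by (simp only:)
  qed
  have nonneg: "0 \<le> ?f t" if "0 \<le> t" for t
    by (rule order_trans[OF _ ge[OF that]]) (use that in \<open>simp add: W_def\<close>)
  have "(\<integral>\<^sup>+t. ennreal (t * tilt_weight \<kappa> (- (real n / 2)) t) * indicator {0..} t \<partial>lborel)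
      \<le> (\<integral>\<^sup>+t. ennreal (?f t) * indicator {0..} t \<partial>lborel)"
    using ge by (intro nn_integral_mono) (auto simp: W_def intro!: ennreal_leI split: split_indicator)
  also have "\<dots> = ennreal (- (1 / B\<^sup>2) * (0 + B * 0) - - (1 / B\<^sup>2) * (W a 0 + B * 0 * W (a - 2) 0))"
  proof (rule nn_integral_FTC_atLeast[OF _ _ nonneg])
    show "DERIV (\<lambda>t. - (1 / B\<^sup>2) * (W a t + B * t * W (a - 2) t)) t :> ?f t" if "0 \<le> t" for t
      unfolding W_def
      by (intro DERIV_cmult DERIV_add DERIV_tilt_weight that DERIV_mult' DERIV_ident)
    have "((\<lambda>t. - (1 / B\<^sup>2) * (W a t + B * (t * W (a - 2) t))) \<longlongrightarrow> - (1 / B\<^sup>2) * (0 + B * 0)) at_top"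
      unfolding W_def using n \<kappa>
      by (intro tendsto_mult_left tendsto_add tendsto_tilt_weight tendsto_times_tilt_weight)
        (auto simp: a_def)
    then show "((\<lambda>t. - (1 / B\<^sup>2) * (W a t + B * t * W (a - 2) t)) \<longlongrightarrow> - (1 / B\<^sup>2) * (0 + B * 0)) at_top"
      by (simp add: mult.assoc)
  qed (simp_all add: W_def)
  finally show ?thesis by (simp add: B_def W_def)
qed

text \<open>The bracket is the mean of \<parallel>X - \<theta>\<parallel>^2 under the law tilted by
  \<open>t\<close>, so this becomes an exact relation between E (Q / S) and E (1 / S). The summand 1
  is the total increase, from 1 - 2 to 0, of
  \<open>tilt_weight \<kappa> a - 2 * tilt_weight \<kappa> (a + 1)\<close> with
  \<open>a = - n / 2\<close>. The additive form avoids truncated subtraction in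
  \<open>ennreal\<close>.\<close>

lemma nn_integral_tilt_weight_recurrence:
  fixes n :: nat
  assumes n: "n \<ge> 4" and \<kappa>: "\<kappa> \<ge> 0"
  defines "W \<equiv> tilt_weight \<kappa> (- (real n / 2))"
  shows "(\<integral>\<^sup>+t. ennreal ((real n / (1 + 2 * t) + \<kappa> * (1 - 1 / (1 + 2 * t))\<^sup>2) * W t) * indicator {0..} t \<partial>lborel) + 1
    = ennreal (\<kappa> + 2 * (real n - 2)) * (\<integral>\<^sup>+t. ennreal (W t) * indicator {0..} t \<partial>lborel)"
proof -
  define a where "a = - (real n / 2)"
  let ?V = "tilt_weight \<kappa>"
  let ?f = "\<lambda>t. (2 * a * ?V (a - 1) t - \<kappa> * ?V (a - 2) t) -
     2 * (2 * (a + 1) * ?V (a + 1 - 1) t - \<kappa> * ?V (a + 1 - 2) t)"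
  let ?g = "\<lambda>t. (real n / (1 + 2 * t) + \<kappa> * (1 - 1 / (1 + 2 * t))\<^sup>2) * W t"
  have [measurable]: "W \<in> borel_measurable borel" by (simp add: W_def)
  have W: "W = ?V a" by (simp add: W_def a_def)
  have f: "?f t = (2 * (real n - 2) + 2 * \<kappa> / (1 + 2 * t) - real n / (1 + 2 * t) - \<kappa> / (1 + 2 * t)\<^sup>2) * W t"
    if "t \<ge> 0" for t
  proof -
    have "a + 1 - 2 = a - 1" "a + 1 - 1 = a" by simp_all
    then have "?f t = (2 * a * (W t / (1 + 2 * t)) - \<kappa> * (W t / (1 + 2 * t)\<^sup>2)) -
        2 * (2 * (a + 1) * W t - \<kappa> * (W t / (1 + 2 * t)))"
      using that by (simp only: tilt_weight_diff_1 tilt_weight_diff_2 W)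
    also have "\<dots> = (2 * (real n - 2) + 2 * \<kappa> / (1 + 2 * t) - real n / (1 + 2 * t) - \<kappa> / (1 + 2 * t)\<^sup>2) * W t"
      by (simp add: a_def algebra_simps)
    finally show ?thesis .
  qed
  \<comment> \<open>The fundamental theorem for nonnegative integrals requires this sign; it holds
    because \<open>2 * (n - 2) \<ge> n\<close> for \<open>n \<ge> 4\<close>.\<close>
  have f0: "0 \<le> ?f t" if "t \<ge> 0" for t
  proof -
    have n': "4 \<le> real n" using n by simp
    have gen: "0 \<le> 2 * (N - 2) + 2 * p - s - q" if "s \<le> N" "q \<le> p" "0 \<le> p" "4 \<le> N" for N p q s :: real
      using that by argo
    have d: "2 * \<kappa> / (1 + 2 * t) = 2 * (\<kappa> / (1 + 2 * t))" by simp
    have "\<kappa> / (1 + 2 * t) / (1 + 2 * t) \<le> \<kappa> / (1 + 2 * t) / 1"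
      using that \<kappa> by (intro divide_left_mono) auto
    moreover have "real n / (1 + 2 * t) \<le> real n / 1"
      using that by (intro divide_left_mono) auto
    ultimately have "real n / (1 + 2 * t) \<le> real n" "\<kappa> / (1 + 2 * t)\<^sup>2 \<le> \<kappa> / (1 + 2 * t)" "0 \<le> \<kappa> / (1 + 2 * t)"
      using that \<kappa> by (auto simp: power2_eq_square)
    then have "0 \<le> 2 * (real n - 2) + 2 * \<kappa> / (1 + 2 * t) - real n / (1 + 2 * t) - \<kappa> / (1 + 2 * t)\<^sup>2"
      unfolding d using n' by (rule gen)
    then show ?thesis unfolding f[OF that] by (simp add: W)
  qed
  have sum: "?g t + ?f t = (\<kappa> + 2 * (real n - 2)) * W t" if "t \<ge> 0" for t
  proof -
    have "1 + 2 * t \<noteq> 0" using that by simp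
    then have "real n / (1 + 2 * t) + \<kappa> * (1 - 1 / (1 + 2 * t))\<^sup>2 +
       (2 * (real n - 2) + 2 * \<kappa> / (1 + 2 * t) - real n / (1 + 2 * t) - \<kappa> / (1 + 2 * t)\<^sup>2) = \<kappa> + 2 * (real n - 2)"
      by (simp add: power2_diff power_divide algebra_simps)
    then show ?thesis unfolding f[OF that] by (metis distrib_right)
  qed
  have "(\<integral>\<^sup>+t. ennreal (?f t) * indicator {0..} t \<partial>lborel) = ennreal ((0 - 2 * 0) - (?V a 0 - 2 * ?V (a + 1) 0))"
  proof (rule nn_integral_FTC_atLeast[OF _ _ f0])
    show "DERIV (\<lambda>t. ?V a t - 2 * ?V (a + 1) t) t :> ?f t" if "0 \<le> t" for t
      by (intro DERIV_diff DERIV_cmult DERIV_tilt_weight that)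
    show "((\<lambda>t. ?V a t - 2 * ?V (a + 1) t) \<longlongrightarrow> 0 - 2 * 0) at_top"
      using n \<kappa> by (intro tendsto_diff tendsto_mult_left tendsto_tilt_weight) (auto simp: a_def)
  qed measurable
  then have "(\<integral>\<^sup>+t. ennreal (?g t) * indicator {0..} t \<partial>lborel) + 1 =
     (\<integral>\<^sup>+t. ennreal (?g t) * indicator {0..} t \<partial>lborel) + (\<integral>\<^sup>+t. ennreal (?f t) * indicator {0..} t \<partial>lborel)"
    by simp
  also have "\<dots> = (\<integral>\<^sup>+t. ennreal (?g t) * indicator {0..} t + ennreal (?f t) * indicator {0..} t \<partial>lborel)"
    by (rule nn_integral_add[symmetric]) measurable
  also have "\<dots> = (\<integral>\<^sup>+t. ennreal (\<kappa> + 2 * (real n - 2)) * (ennreal (W t) * indicator {0..} t) \<partial>lborel)"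
  proof (intro nn_integral_cong)
    fix t :: real
    show "ennreal (?g t) * indicator {0..} t + ennreal (?f t) * indicator {0..} t =
        ennreal (\<kappa> + 2 * (real n - 2)) * (ennreal (W t) * indicator {0..} t)"
    proof (cases "t \<ge> 0")
      case True
      have "ennreal (?g t) + ennreal (?f t) = ennreal (?g t + ?f t)"
        using True \<kappa> f0[OF True] by (intro ennreal_plus[symmetric]) (auto simp: W)
      also have "\<dots> = ennreal (\<kappa> + 2 * (real n - 2)) * ennreal (W t)"
        unfolding sum[OF True] using n \<kappa> by (intro ennreal_mult) (auto simp: W)
      finally show ?thesis using True by simp
    qed simp
  qed
  also have "\<dots> = ennreal (\<kappa> + 2 * (real n - 2)) * (\<integral>\<^sup>+t. ennreal (W t) * indicator {0..} t \<partial>lborel)"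
    by (rule nn_integral_cmult) measurable
  finally show ?thesis .
qed

section \<open>Exponential tilting of Gaussian laws and Laplace representations\<close>

lemma normal_density_n_tilt:
  assumes t: "t \<ge> 0"
  shows "normal_density_n n \<theta> 1 x * exp (- (t * (vnorm n x)\<^sup>2)) =
    tilt_weight ((vnorm n \<theta>)\<^sup>2) (- (real n / 2)) t *
      normal_density_n n (\<lambda>i. \<theta> i / (1 + 2 * t)) (1 / (1 + 2 * t)) x"
proof -
  define w where "w = 1 + 2 * t"
  have w: "w > 0" using t by (simp add: w_def)
  define P where "P = (\<Sum>i<n. x i * \<theta> i)"
  have q: "(vnorm n (\<lambda>i. x i - c * \<theta> i))\<^sup>2 = (vnorm n x)\<^sup>2 - 2 * c * P + c\<^sup>2 * (vnorm n \<theta>)\<^sup>2" for c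
    by (simp add: vnorm_sq P_def power2_diff sum.distrib sum_subtractf sum_distrib_left power_mult_distrib
        mult_ac)
  \<comment> \<open>Completing the square: the tilted exponent is that of a Gaussian with mean
    \<open>\<theta> / w\<close> and variance \<open>1 / w\<close>, up to a constant.\<close>
  have e: "- (vnorm n (\<lambda>i. x i - \<theta> i))\<^sup>2 / (2 * 1) + - (t * (vnorm n x)\<^sup>2) =
      - ((vnorm n \<theta>)\<^sup>2 * t / w) + - (vnorm n (\<lambda>i. x i - \<theta> i / w))\<^sup>2 / (2 * (1 / w))"
  proof -
    have q1: "(vnorm n (\<lambda>i. x i - \<theta> i))\<^sup>2 = (vnorm n x)\<^sup>2 - 2 * P + (vnorm n \<theta>)\<^sup>2"
      using q[of 1] by simp
    have q2: "(vnorm n (\<lambda>i. x i - \<theta> i / w))\<^sup>2 = (vnorm n x)\<^sup>2 - 2 * P / w + (vnorm n \<theta>)\<^sup>2 / w\<^sup>2"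
      using q[of "1 / w"] by (simp add: power_divide)
    have tw: "t = (w - 1) / 2" by (simp add: w_def)
    show ?thesis
      unfolding q1 q2 tw using w by (simp add: power2_eq_square field_simps)
  qed
  have p: "(2 * pi * (1 / w)) powr (- (real n / 2)) = (2 * pi * 1) powr (- (real n / 2)) * w powr (real n / 2)"
    using w by (simp add: powr_divide powr_minus field_simps)
  have p': "w powr (real n / 2) * w powr (- (real n / 2)) = 1"
    using w by (simp add: powr_minus)
  have "1 / w > 0" using w by simp
  then have nd: "normal_density_n n (\<lambda>i. \<theta> i / w) (1 / w) x =
      (2 * pi * 1) powr (- (real n / 2)) * w powr (real n / 2) *
      exp (- (vnorm n (\<lambda>i. x i - \<theta> i / w))\<^sup>2 / (2 * (1 / w)))"
    by (simp only: normal_density_n_eq p)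
  have "normal_density_n n \<theta> 1 x * exp (- (t * (vnorm n x)\<^sup>2)) = (2 * pi * 1) powr (- (real n / 2)) *
      exp (- (vnorm n (\<lambda>i. x i - \<theta> i))\<^sup>2 / (2 * 1) + - (t * (vnorm n x)\<^sup>2))"
    by (simp only: normal_density_n_eq zero_less_one exp_add mult.assoc)
  also have "\<dots> = (2 * pi * 1) powr (- (real n / 2)) * (w powr (real n / 2) * w powr (- (real n / 2))) *
      exp (- ((vnorm n \<theta>)\<^sup>2 * t / w)) * exp (- (vnorm n (\<lambda>i. x i - \<theta> i / w))\<^sup>2 / (2 * (1 / w)))"
    unfolding e p' exp_add by simp
  also have "\<dots> = tilt_weight ((vnorm n \<theta>)\<^sup>2) (- (real n / 2)) t * normal_density_n n (\<lambda>i. \<theta> i / w) (1 / w) x"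
    unfolding tilt_weight_def w_def[symmetric] nd by (simp only: ac_simps)
  finally show ?thesis unfolding w_def .
qed

lemma nn_integral_normal_law_n_tilt:
  assumes t: "t \<ge> 0" and g [measurable]: "g \<in> borel_measurable (lborel_n n)"
  shows "(\<integral>\<^sup>+x. g x * ennreal (exp (- (t * (vnorm n x)\<^sup>2))) \<partial>normal_law_n n \<theta> 1) =
    ennreal (tilt_weight ((vnorm n \<theta>)\<^sup>2) (- (real n / 2)) t) *
      (\<integral>\<^sup>+x. g x \<partial>normal_law_n n (\<lambda>i. \<theta> i / (1 + 2 * t)) (1 / (1 + 2 * t)))"
proof -
  let ?d = "normal_density_n n (\<lambda>i. \<theta> i / (1 + 2 * t)) (1 / (1 + 2 * t))"
  have pos: "?d x \<ge> 0" for x using t by (intro less_imp_le normal_density_n_pos) simp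
  have "(\<integral>\<^sup>+x. g x * ennreal (exp (- (t * (vnorm n x)\<^sup>2))) \<partial>normal_law_n n \<theta> 1) =
      (\<integral>\<^sup>+x. ennreal (normal_density_n n \<theta> 1 x) * (g x * ennreal (exp (- (t * (vnorm n x)\<^sup>2)))) \<partial>lborel_n n)"
    unfolding normal_law_n_def by (subst nn_integral_density) auto
  also have "\<dots> = (\<integral>\<^sup>+x. ennreal (tilt_weight ((vnorm n \<theta>)\<^sup>2) (- (real n / 2)) t) * (ennreal (?d x) * g x) \<partial>lborel_n n)"
  proof (intro nn_integral_cong)
    fix x
    have "ennreal (normal_density_n n \<theta> 1 x) * (g x * ennreal (exp (- (t * (vnorm n x)\<^sup>2)))) =
        ennreal (normal_density_n n \<theta> 1 x * exp (- (t * (vnorm n x)\<^sup>2))) * g x"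
      by (simp add: ennreal_mult normal_density_n_pos less_imp_le mult_ac)
    also have "\<dots> = ennreal (tilt_weight ((vnorm n \<theta>)\<^sup>2) (- (real n / 2)) t) * (ennreal (?d x) * g x)"
      unfolding normal_density_n_tilt[OF t] using pos by (simp add: ennreal_mult mult_ac)
    finally show "ennreal (normal_density_n n \<theta> 1 x) * (g x * ennreal (exp (- (t * (vnorm n x)\<^sup>2)))) = \<dots>" .
  qed
  also have "\<dots> = ennreal (tilt_weight ((vnorm n \<theta>)\<^sup>2) (- (real n / 2)) t) *
      (\<integral>\<^sup>+x. g x \<partial>normal_law_n n (\<lambda>i. \<theta> i / (1 + 2 * t)) (1 / (1 + 2 * t)))"
    unfolding normal_law_n_def
    by (subst nn_integral_cmult) (auto simp: nn_integral_density)
  finally show ?thesis .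
qed

text \<open>Where the norm vanishes, division yields 0 by convention and the Laplace representation
  of \<open>1 / S\<close> fails. A single nonzero coordinate rules this out.\<close>

lemma AE_normal_law_n_vnorm_pos:
  assumes "n \<ge> 1" "v > 0"
  shows "AE x in normal_law_n n \<mu> v. 0 < (vnorm n x)\<^sup>2"
proof -
  let ?N = "\<lambda>i. density lborel (normal_density (\<mu> i) (sqrt v))"
  have "AE x in normal_law_n n \<mu> v. x 0 \<noteq> 0"
    unfolding normal_law_n_eq_PiM[OF assms(2)]
  proof (rule AE_PiM_component)
    show "prob_space (?N i)" for i
      using assms by (intro prob_space_normal_density) simp
    show "AE x in ?N 0. x \<noteq> 0"
      using AE_lborel_singleton[of 0] by (subst AE_density) (auto elim: AE_mp)
  qed (use assms in auto)
  then show ?thesis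
  proof eventually_elim
    case (elim x)
    have "0 < (x 0)\<^sup>2" using elim by simp
    also have "\<dots> \<le> (\<Sum>i<n. (x i)\<^sup>2)"
      using assms by (intro member_le_sum) auto
    finally show ?case by (simp only: vnorm_sq)
  qed
qed

text \<open>Tonelli's theorem reduces inverse moments of \<open>\<parallel>X\<parallel>\<^sup>2\<close> to one-dimensional integrals over \<open>t\<close>, because
  multiplying a Gaussian density by \<open>exp (- t \<parallel>x\<parallel>\<^sup>2)\<close> gives another Gaussian density up to a factor.\<close>

lemma nn_integral_laplace_normal_law_n:
  fixes h H :: "real \<Rightarrow> real"
  assumes n: "n \<ge> 1"
    and g [measurable]: "g \<in> borel_measurable (lborel_n n)"
    and h [measurable]: "h \<in> borel_measurable borel"
    and h0: "\<And>t. t \<ge> 0 \<Longrightarrow> h t \<ge> 0"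
    and H: "\<And>s. s > 0 \<Longrightarrow> (\<integral>\<^sup>+t. ennreal (h t * exp (- (t * s))) * indicator {0..} t \<partial>lborel) = ennreal (H s)"
  shows "(\<integral>\<^sup>+x. g x * ennreal (H ((vnorm n x)\<^sup>2)) \<partial>normal_law_n n \<theta> 1) =
    (\<integral>\<^sup>+t. ennreal (h t * tilt_weight ((vnorm n \<theta>)\<^sup>2) (- (real n / 2)) t) *
      (\<integral>\<^sup>+x. g x \<partial>normal_law_n n (\<lambda>i. \<theta> i / (1 + 2 * t)) (1 / (1 + 2 * t))) * indicator {0..} t \<partial>lborel)"
proof -
  let ?L = "normal_law_n n \<theta> 1"
  interpret L: prob_space ?L by (rule prob_space_normal_law_n) simp
  interpret pair_sigma_finite ?L "lborel :: real measure" ..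
  have "(\<integral>\<^sup>+x. g x * ennreal (H ((vnorm n x)\<^sup>2)) \<partial>?L) =
      (\<integral>\<^sup>+x. (\<integral>\<^sup>+t. g x * (ennreal (h t * exp (- (t * (vnorm n x)\<^sup>2))) * indicator {0..} t) \<partial>lborel) \<partial>?L)"
    using AE_normal_law_n_vnorm_pos[OF n zero_less_one, of \<theta>]
    by (intro nn_integral_cong_AE, eventually_elim) (simp add: nn_integral_cmult H)
  also have "\<dots> = (\<integral>\<^sup>+t. (\<integral>\<^sup>+x. g x * (ennreal (h t * exp (- (t * (vnorm n x)\<^sup>2))) * indicator {0..} t) \<partial>?L) \<partial>lborel)"
    by (rule Fubini'[symmetric]) measurable
  also have "\<dots> = (\<integral>\<^sup>+t. ennreal (h t * tilt_weight ((vnorm n \<theta>)\<^sup>2) (- (real n / 2)) t) *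
      (\<integral>\<^sup>+x. g x \<partial>normal_law_n n (\<lambda>i. \<theta> i / (1 + 2 * t)) (1 / (1 + 2 * t))) * indicator {0..} t \<partial>lborel)"
  proof (intro nn_integral_cong)
    fix t :: real
    show "(\<integral>\<^sup>+x. g x * (ennreal (h t * exp (- (t * (vnorm n x)\<^sup>2))) * indicator {0..} t) \<partial>?L) =
        ennreal (h t * tilt_weight ((vnorm n \<theta>)\<^sup>2) (- (real n / 2)) t) *
        (\<integral>\<^sup>+x. g x \<partial>normal_law_n n (\<lambda>i. \<theta> i / (1 + 2 * t)) (1 / (1 + 2 * t))) * indicator {0..} t"
    proof (cases "t \<ge> 0")
      case True
      have "(\<integral>\<^sup>+x. g x * ennreal (h t * exp (- (t * (vnorm n x)\<^sup>2))) \<partial>?L) =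
          (\<integral>\<^sup>+x. ennreal (h t) * (g x * ennreal (exp (- (t * (vnorm n x)\<^sup>2)))) \<partial>?L)"
        using h0[OF True] by (simp add: ennreal_mult mult_ac)
      also have "\<dots> = ennreal (h t) * (\<integral>\<^sup>+x. g x * ennreal (exp (- (t * (vnorm n x)\<^sup>2))) \<partial>?L)"
        by (rule nn_integral_cmult) measurable
      finally show ?thesis
        using True h0[OF True] by (simp add: nn_integral_normal_law_n_tilt ennreal_mult mult_ac)
    qed simp
  qed
  finally show ?thesis .
qed

text \<open>The factor \<open>1\<close> stands for the constant function \<open>h\<close> of the
  Laplace lemma and keeps the shape of its premise.\<close>

lemma nn_integral_exp_Ici:
  assumes s: "s > 0"
  shows "(\<integral>\<^sup>+t. ennreal (1 * exp (- (t * s))) * indicator {0..} t \<partial>lborel) = ennreal (1 / s)"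
proof -
  have "(\<integral>\<^sup>+t. ennreal (1 * exp (- (t * s))) * indicator {0..} t \<partial>lborel) = ennreal (0 - - (1 / s) * exp (- (0 * s)))"
  proof (rule nn_integral_FTC_atLeast)
    show "((\<lambda>t. - (1 / s) * exp (- (t * s))) has_real_derivative 1 * exp (- (t * s))) (at t)" for t
      using s by (auto intro!: derivative_eq_intros)
    show "((\<lambda>t. - (1 / s) * exp (- (t * s))) \<longlongrightarrow> 0) at_top"
      using s by real_asymp
  qed auto
  then show ?thesis by simp
qed

lemma nn_integral_times_exp_Ici:
  assumes s: "s > 0"
  shows "(\<integral>\<^sup>+t. ennreal (t * exp (- (t * s))) * indicator {0..} t \<partial>lborel) = ennreal (1 / s\<^sup>2)"
proof -
  have "(\<integral>\<^sup>+t. ennreal (t * exp (- (t * s))) * indicator {0..} t \<partial>lborel) =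
      ennreal (0 - - (0 / s + 1 / s\<^sup>2) * exp (- (0 * s)))"
  proof (rule nn_integral_FTC_atLeast)
    show "((\<lambda>t. - (t / s + 1 / s\<^sup>2) * exp (- (t * s))) has_real_derivative t * exp (- (t * s))) (at t)" for t
      using s by (auto intro!: derivative_eq_intros simp: field_simps power2_eq_square)
    show "((\<lambda>t. - (t / s + 1 / s\<^sup>2) * exp (- (t * s))) \<longlongrightarrow> 0) at_top"
      using s by real_asymp
  qed auto
  then show ?thesis by simp
qed

subsection \<open>The James-Stein loss\<close>

text \<open>The threshold gives \<open>M \<ge> 16\<close>, hence \<open>M - 8 \<ge> M / 2\<close>,
  which the second inverse moment requires; only large dimensions matter for the
  asymptotics.\<close>

locale gaussian_shift =
  fixes n :: nat and \<theta> :: "nat \<Rightarrow> real"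
  assumes n16: "n \<ge> 16"
begin

abbreviation law :: "(nat \<Rightarrow> real) measure" where
  "law \<equiv> normal_law_n n \<theta> 1"

abbreviation S :: "(nat \<Rightarrow> real) \<Rightarrow> real" where
  "S x \<equiv> (vnorm n x)\<^sup>2"

abbreviation Q :: "(nat \<Rightarrow> real) \<Rightarrow> real" where
  "Q x \<equiv> (vnorm n (\<lambda>i. x i - \<theta> i))\<^sup>2"

abbreviation loss :: "(nat \<Rightarrow> real) \<Rightarrow> real" where
  "loss x \<equiv> (vnorm n (\<lambda>i. james_stein n x i - \<theta> i))\<^sup>2"

definition M :: real where "M = real n + (vnorm n \<theta>)\<^sup>2"

definition D :: real where "D = (vnorm n \<theta>)\<^sup>2 / M"

lemma n16': "16 \<le> real n"
  using n16 by simp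

lemma M_ge: "real n \<le> M"
  by (simp add: M_def)

lemma M_pos: "0 < M" "16 \<le> M"
  using M_ge n16' by linarith+

lemma D_bounds: "0 \<le> D" "D \<le> 1"
  using M_pos n16' by (auto simp: D_def M_def field_simps)

lemma D_eq: "D = 1 - real n / M"
  using M_pos by (simp add: D_def M_def field_simps)

sublocale prob_space law
  by (rule prob_space_normal_law_n) simp

lemma AE_S_pos: "AE x in law. 0 < S x"
  using n16 by (intro AE_normal_law_n_vnorm_pos) auto

lemma expectation_S: "has_bochner_integral law S M"
  using expectation_sq_dist[of 1 n \<theta> "\<lambda>_. 0"] by (simp add: M_def)

lemma expectation_Q: "has_bochner_integral law Q (real n)"
  using expectation_sq_dist[of 1 n \<theta> \<theta>] by (simp add: vnorm_sq)

abbreviation weight :: "real \<Rightarrow> real" where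
  "weight \<equiv> tilt_weight ((vnorm n \<theta>)\<^sup>2) (- (real n / 2))"

text \<open>This is the expectation of \<open>1 / S\<close>, taken in its one-dimensional form so
  that the bounds on tilted weights apply directly. The integral is finite, so
  \<open>enn2real\<close> loses nothing.\<close>

definition inv_S :: real where
  "inv_S = enn2real (\<integral>\<^sup>+t. ennreal (weight t) * indicator {0..} t \<partial>lborel)"

lemma nn_integral_weight:
  "(\<integral>\<^sup>+t. ennreal (weight t) * indicator {0..} t \<partial>lborel) = ennreal inv_S"
  "inv_S \<le> 1 / (M - 4)" "0 \<le> inv_S"
proof -
  let ?F = "\<integral>\<^sup>+t. ennreal (weight t) * indicator {0..} t \<partial>lborel"
  have le: "?F \<le> ennreal (1 / (M - 4))"
    using nn_integral_tilt_weight_le[of n "(vnorm n \<theta>)\<^sup>2"] n16 by (simp add: M_def algebra_simps)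
  then have "?F \<noteq> \<top>" using le_ennreal_iff neq_top_trans ennreal_neq_top by metis
  then show *: "?F = ennreal inv_S" unfolding inv_S_def by (simp add: ennreal_enn2real_if)
  show "0 \<le> inv_S" by (simp add: inv_S_def)
  have "0 \<le> 1 / (M - 4)" using M_pos by simp
  then show "inv_S \<le> 1 / (M - 4)" using le unfolding * by (simp add: ennreal_le_iff)
qed

lemma expectation_inv_S: "has_bochner_integral law (\<lambda>x. 1 / S x) inv_S"
proof (rule has_bochner_integral_nn_integral)
  have "(\<integral>\<^sup>+x. 1 * ennreal (1 / S x) \<partial>law) =
    (\<integral>\<^sup>+t. ennreal (1 * weight t) *
      (\<integral>\<^sup>+x. 1 \<partial>normal_law_n n (\<lambda>i. \<theta> i / (1 + 2 * t)) (1 / (1 + 2 * t))) * indicator {0..} t \<partial>lborel)"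
    using n16 by (intro nn_integral_laplace_normal_law_n nn_integral_exp_Ici) auto
  also have "\<dots> = (\<integral>\<^sup>+t. ennreal (weight t) * indicator {0..} t \<partial>lborel)"
    by (intro nn_integral_cong)
      (auto simp: indicator_def prob_space.emeasure_space_1 prob_space_normal_law_n)
  finally show "(\<integral>\<^sup>+x. ennreal (1 / S x) \<partial>law) = ennreal inv_S"
    by (simp add: nn_integral_weight)
qed (auto simp: nn_integral_weight)

lemma expectation_inv_S_sq:
  obtains c where "has_bochner_integral law (\<lambda>x. 1 / (S x)\<^sup>2) c" "c \<le> 1 / (M - 8)\<^sup>2"
proof -
  have "(\<integral>\<^sup>+x. 1 * ennreal (1 / (S x)\<^sup>2) \<partial>law) =
    (\<integral>\<^sup>+t. ennreal (t * weight t) *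
      (\<integral>\<^sup>+x. 1 \<partial>normal_law_n n (\<lambda>i. \<theta> i / (1 + 2 * t)) (1 / (1 + 2 * t))) * indicator {0..} t \<partial>lborel)"
    using n16 by (intro nn_integral_laplace_normal_law_n[where H = "\<lambda>s. 1 / s\<^sup>2"] nn_integral_times_exp_Ici) auto
  also have "\<dots> = (\<integral>\<^sup>+t. ennreal (t * weight t) * indicator {0..} t \<partial>lborel)"
    by (intro nn_integral_cong)
      (auto simp: indicator_def prob_space.emeasure_space_1 prob_space_normal_law_n)
  also have "\<dots> \<le> ennreal (1 / (M - 8)\<^sup>2)"
    using nn_integral_times_tilt_weight_le[of n "(vnorm n \<theta>)\<^sup>2"] n16 by (simp add: M_def algebra_simps)
  finally have le: "(\<integral>\<^sup>+x. ennreal (1 / (S x)\<^sup>2) \<partial>law) \<le> ennreal (1 / (M - 8)\<^sup>2)" by simp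
  then obtain c where c: "c \<ge> 0" "(\<integral>\<^sup>+x. ennreal (1 / (S x)\<^sup>2) \<partial>law) = ennreal c"
    by (cases "\<integral>\<^sup>+x. ennreal (1 / (S x)\<^sup>2) \<partial>law") (auto simp: top_unique)
  show ?thesis
  proof
    show "has_bochner_integral law (\<lambda>x. 1 / (S x)\<^sup>2) c"
      using c by (intro has_bochner_integral_nn_integral) auto
    show "c \<le> 1 / (M - 8)\<^sup>2" using le c by simp
  qed
qed

text \<open>Tilting shrinks the mean to \<open>\<theta> / (1 + 2 * t)\<close>, so \<open>Q\<close>
  acquires a squared bias next to its variance. The recurrence expresses the weighted average of
  both through \<open>inv_S\<close>, which does the work of Stein's identity.\<close>

lemma expectation_Q_div_S:
  "has_bochner_integral law (\<lambda>x. Q x / S x) (((vnorm n \<theta>)\<^sup>2 + 2 * (real n - 2)) * inv_S - 1)"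
proof -
  let ?\<kappa> = "(vnorm n \<theta>)\<^sup>2" and ?c = "(vnorm n \<theta>)\<^sup>2 + 2 * (real n - 2)"
  let ?J = "\<integral>\<^sup>+x. ennreal (Q x / S x) \<partial>law"
  have tilted: "(\<integral>\<^sup>+x. ennreal (Q x) \<partial>normal_law_n n (\<lambda>i. \<theta> i / (1 + 2 * t)) (1 / (1 + 2 * t))) =
      ennreal (real n / (1 + 2 * t) + ?\<kappa> * (1 - 1 / (1 + 2 * t))\<^sup>2)" if t: "t \<ge> 0" for t
  proof -
    let ?T = "normal_law_n n (\<lambda>i. \<theta> i / (1 + 2 * t)) (1 / (1 + 2 * t))"
    have "has_bochner_integral ?T Q
        (real n * (1 / (1 + 2 * t)) + (vnorm n (\<lambda>i. \<theta> i / (1 + 2 * t) - \<theta> i))\<^sup>2)"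
      using t by (intro expectation_sq_dist) auto
    moreover have "(vnorm n (\<lambda>i. \<theta> i / (1 + 2 * t) - \<theta> i))\<^sup>2 = ?\<kappa> * (1 - 1 / (1 + 2 * t))\<^sup>2"
    proof -
      have "(\<theta> i / (1 + 2 * t) - \<theta> i)\<^sup>2 = (\<theta> i)\<^sup>2 * (1 - 1 / (1 + 2 * t))\<^sup>2" for i
        by (simp add: power2_eq_square algebra_simps)
      then show ?thesis by (simp add: vnorm_sq sum_distrib_right)
    qed
    ultimately show ?thesis
      by (subst nn_integral_eq_integral) (auto simp: has_bochner_integral_iff)
  qed
  have "(\<integral>\<^sup>+x. ennreal (Q x) * ennreal (1 / S x) \<partial>law) =
    (\<integral>\<^sup>+t. ennreal (1 * weight t) *
      (\<integral>\<^sup>+x. ennreal (Q x) \<partial>normal_law_n n (\<lambda>i. \<theta> i / (1 + 2 * t)) (1 / (1 + 2 * t))) * indicator {0..} t \<partial>lborel)"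
    using n16 by (intro nn_integral_laplace_normal_law_n nn_integral_exp_Ici) auto
  also have "\<dots> = (\<integral>\<^sup>+t. ennreal ((real n / (1 + 2 * t) + ?\<kappa> * (1 - 1 / (1 + 2 * t))\<^sup>2) * weight t) *
      indicator {0..} t \<partial>lborel)"
  proof (intro nn_integral_cong)
    fix t :: real
    show "ennreal (1 * weight t) *
        (\<integral>\<^sup>+x. ennreal (Q x) \<partial>normal_law_n n (\<lambda>i. \<theta> i / (1 + 2 * t)) (1 / (1 + 2 * t))) * indicator {0..} t =
      ennreal ((real n / (1 + 2 * t) + ?\<kappa> * (1 - 1 / (1 + 2 * t))\<^sup>2) * weight t) * indicator {0..} t"
    proof (cases "t \<ge> 0")
      case True
      then show ?thesis
        unfolding tilted[OF True] by (subst mult.commute[of _ "weight t"]) (simp add: ennreal_mult)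
    qed simp
  qed
  finally have "?J + 1 = ennreal ?c * ennreal inv_S"
    using nn_integral_tilt_weight_recurrence[of n ?\<kappa>] n16
    by (simp add: nn_integral_weight ennreal_mult[symmetric])
  also have "\<dots> = ennreal (?c * inv_S)"
    using n16' by (intro ennreal_mult[symmetric]) (auto simp: nn_integral_weight)
  finally have *: "?J + 1 = ennreal (?c * inv_S)" .
  then obtain j where j: "j \<ge> 0" "?J = ennreal j"
    by (cases ?J) auto
  have "ennreal (j + 1) = ennreal (?c * inv_S)"
    using * j by (simp add: ennreal_plus)
  moreover have "0 \<le> ?c * inv_S"
    using n16' by (intro mult_nonneg_nonneg) (auto simp: nn_integral_weight)
  moreover have "0 \<le> j + 1" using j by simp
  ultimately have "j + 1 = ?c * inv_S" using ennreal_inj by blast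
  then have "j = ?c * inv_S - 1" by simp
  then show ?thesis
    using j by (intro has_bochner_integral_nn_integral) auto
qed

text \<open>Jensen's inequality, through the tangent \<open>2 / M - s / M^2\<close> of
  \<open>1 / s\<close> at the mean \<open>s = M\<close>.\<close>

lemma inv_S_ge: "1 / M \<le> inv_S"
proof -
  have "has_bochner_integral law (\<lambda>x. 2 / M - S x / M\<^sup>2) (2 / M - M / M\<^sup>2)"
    by (intro has_bochner_integral_diff has_bochner_integral_divide expectation_S)
      (simp add: has_bochner_integral_iff prob_space)
  moreover have "AE x in law. 2 / M - S x / M\<^sup>2 \<le> 1 / S x"
    using AE_S_pos
  proof eventually_elim
    case (elim x)
    have "1 / s - (2 / M - s / M\<^sup>2) = (s - M)\<^sup>2 / (M\<^sup>2 * s)" if "s > 0" for s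
      using that M_pos by (simp add: power2_eq_square field_simps)
    from this[OF elim] show ?case
      using elim by (smt (verit) divide_nonneg_nonneg mult_nonneg_nonneg zero_le_power2)
  qed
  ultimately have "2 / M - M / M\<^sup>2 \<le> inv_S"
    using expectation_inv_S integral_mono_AE[of law "\<lambda>x. 2 / M - S x / M\<^sup>2" "\<lambda>x. 1 / S x"]
    by (simp add: has_bochner_integral_iff)
  then show ?thesis using M_pos by (simp add: power2_eq_square)
qed

text \<open>Expanding the square and eliminating the inner product of \<open>x\<close> and \<theta>
  in favour of \<open>Q\<close> leaves only terms with known expectations: \<open>Q\<close>,
  \<open>1 / S\<close> and \<open>Q / S\<close>.\<close>

lemma loss_eq:
  assumes "0 < S x"
  shows "loss x = Q x - (real n - 2) + (real n - 2) / S x * ((vnorm n \<theta>)\<^sup>2 - Q x + (real n - 2))"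
proof -
  define P where "P = (\<Sum>i<n. x i * \<theta> i)"
  define c where "c = 1 - (real n - 2) / S x"
  have q: "(vnorm n (\<lambda>i. x i * c - \<theta> i))\<^sup>2 = c\<^sup>2 * S x - 2 * c * P + (vnorm n \<theta>)\<^sup>2" for c
    by (simp add: vnorm_sq P_def power2_diff sum.distrib sum_subtractf sum_distrib_left power_mult_distrib mult_ac)
  have Q: "Q x = S x - 2 * P + (vnorm n \<theta>)\<^sup>2"
    using q[of 1] by simp
  have "loss x = c\<^sup>2 * S x - 2 * c * P + (vnorm n \<theta>)\<^sup>2"
    by (simp add: james_stein_def c_def[symmetric] q)
  also have "\<dots> = Q x - (real n - 2) + (real n - 2) / S x * ((vnorm n \<theta>)\<^sup>2 - Q x + (real n - 2))"
  proof -
    have "(1 - m / s)\<^sup>2 * s - 2 * (1 - m / s) * P + k = s - 2 * P + k - m + m / s * (k - (s - 2 * P + k) + m)"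
      if "s > 0" for s m k :: real
      using that by (simp add: power2_eq_square field_simps)
    from this[OF assms] show ?thesis unfolding Q c_def .
  qed
  finally show ?thesis .
qed

definition R :: real where
  "R = real n - (real n - 2)\<^sup>2 * inv_S"

lemma measurable_loss [measurable]: "loss \<in> borel_measurable (lborel_n n)"
  unfolding vnorm_sq james_stein_def by measurable

lemma expectation_loss: "has_bochner_integral law loss R"
proof -
  let ?m = "real n - 2" and ?\<kappa> = "(vnorm n \<theta>)\<^sup>2"
  let ?J = "(?\<kappa> + 2 * ?m) * inv_S - 1"
  have "has_bochner_integral law (\<lambda>x. Q x - ?m + (?m * ?\<kappa> + ?m\<^sup>2) * (1 / S x) - ?m * (Q x / S x))
     (real n - ?m + (?m * ?\<kappa> + ?m\<^sup>2) * inv_S - ?m * ?J)"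
    by (intro has_bochner_integral_diff has_bochner_integral_add has_bochner_integral_mult_right
        expectation_Q expectation_inv_S expectation_Q_div_S)
      (simp_all add: has_bochner_integral_iff prob_space)
  \<comment> \<open>The terms with \<kappa> cancel, and the coefficient of \<open>inv_S\<close>
    becomes \<open>?m^2 - 2 * ?m^2\<close>.\<close>
  also have "real n - ?m + (?m * ?\<kappa> + ?m\<^sup>2) * inv_S - ?m * ?J = R"
    by (simp add: R_def power2_eq_square algebra_simps)
  finally have *: "has_bochner_integral law (\<lambda>x. Q x - ?m + (?m * ?\<kappa> + ?m\<^sup>2) * (1 / S x) - ?m * (Q x / S x)) R" .
  show ?thesis
  proof (rule has_bochner_integralI_AE[OF *])
    show "AE x in law. Q x - ?m + (?m * ?\<kappa> + ?m\<^sup>2) * (1 / S x) - ?m * (Q x / S x) = loss x"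
      using AE_S_pos
    proof eventually_elim
      case (elim x)
      have "q - m + (m * k + m\<^sup>2) * (1 / s) - m * (q / s) = q - m + m / s * (k - q + m)"
        if "s > 0" for s q m k :: real
        using that by (simp add: power2_eq_square field_simps)
      from this[OF elim] show ?case unfolding loss_eq[OF elim] .
    qed
  qed measurable
qed

text \<open>The difference is \<open>n^2 / M - (n - 2)^2 * inv_S\<close>. Both terms may be of order
  n, but the bounds \<open>1 / M\<close> and \<open>1 / (M - 4)\<close> on \<open>inv_S\<close> are
  close enough, given \<open>n \<le> M\<close>, to leave O(1).\<close>

lemma R_close: "\<bar>R - real n * D\<bar> \<le> 4"
proof -
  have "R - real n * D = (real n)\<^sup>2 / M - (real n - 2)\<^sup>2 * inv_S"
    by (simp add: R_def D_eq power2_eq_square algebra_simps)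
  moreover have "(real n - 2)\<^sup>2 * (1 / M) \<le> (real n - 2)\<^sup>2 * inv_S"
    by (intro mult_left_mono inv_S_ge) simp
  moreover have "(real n - 2)\<^sup>2 * inv_S \<le> (real n - 2)\<^sup>2 * (1 / (M - 4))"
    by (intro mult_left_mono nn_integral_weight) simp
  moreover have "(real n)\<^sup>2 / M - (real n - 2)\<^sup>2 * (1 / M) \<le> 4"
  proof -
    have "(real n)\<^sup>2 / M - (real n - 2)\<^sup>2 * (1 / M) = (4 * real n - 4) / M"
      by (simp add: power2_eq_square diff_divide_distrib[symmetric] algebra_simps)
    then show ?thesis using M_pos M_ge by (simp add: divide_le_eq)
  qed
  moreover have "(real n - 2)\<^sup>2 * (1 / (M - 4)) - (real n)\<^sup>2 / M \<le> 4"
  proof -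
    have "(real n - 2)\<^sup>2 * M - (real n)\<^sup>2 * (M - 4) = 4 * real n * (real n - M) + 4 * M"
      by (simp add: power2_eq_square algebra_simps)
    also have "\<dots> \<le> 4 * M"
      using M_ge by (simp add: mult_nonneg_nonpos)
    also have "\<dots> \<le> 4 * M * (M - 4)"
      using M_pos by simp
    finally have "(real n - 2)\<^sup>2 * M - (real n)\<^sup>2 * (M - 4) \<le> 4 * M * (M - 4)" .
    then show ?thesis using M_pos by (simp add: field_simps)
  qed
  ultimately show ?thesis by (simp add: abs_le_iff)
qed

text \<open>The fluctuation of the James-Stein shrinkage about \<open>n / M = 1 - D\<close>. Its
  root mean square is of order sqrt n / M.\<close>

definition dev :: "(nat \<Rightarrow> real) \<Rightarrow> real" where
  "dev x = (real n - 2) / S x - real n / M"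

text \<open>In the expanded square the second inverse moment needs its upper bound and the first,
  entering with a minus sign, its lower bound. Terms of order n^2 then cancel, up to
  \<open>(n - 2)^2 * (M^2 / (M - 8)^2 - 1)\<close> and the square 4 of the gap between n and n -
  2.\<close>

lemma expectation_dev_sq:
  obtains c where "has_bochner_integral law (\<lambda>x. (dev x)\<^sup>2) c" "M\<^sup>2 * c \<le> 68 * real n"
proof -
  let ?m = "real n - 2"
  obtain i2 where i2: "has_bochner_integral law (\<lambda>x. 1 / (S x)\<^sup>2) i2" "i2 \<le> 1 / (M - 8)\<^sup>2"
    by (rule expectation_inv_S_sq)
  have "has_bochner_integral law (\<lambda>x. ?m\<^sup>2 * (1 / (S x)\<^sup>2) - 2 * ?m * (real n / M) * (1 / S x) + (real n / M)\<^sup>2)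
      (?m\<^sup>2 * i2 - 2 * ?m * (real n / M) * inv_S + (real n / M)\<^sup>2)"
    by (intro has_bochner_integral_diff has_bochner_integral_add has_bochner_integral_mult_right
        expectation_inv_S i2(1)) (simp add: has_bochner_integral_iff prob_space)
  moreover have "?m\<^sup>2 * (1 / (S x)\<^sup>2) - 2 * ?m * (real n / M) * (1 / S x) + (real n / M)\<^sup>2 = (dev x)\<^sup>2" for x
    by (simp add: dev_def power2_diff power_divide)
  moreover have "M\<^sup>2 * (?m\<^sup>2 * i2 - 2 * ?m * (real n / M) * inv_S + (real n / M)\<^sup>2) \<le> 68 * real n"
  proof -
    have M8: "M - 8 > 0" using M_pos by simp
    have "?m\<^sup>2 * i2 \<le> ?m\<^sup>2 * (1 / (M - 8)\<^sup>2)" using i2 by (intro mult_left_mono) auto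
    moreover have "2 * ?m * (real n / M) * (1 / M) \<le> 2 * ?m * (real n / M) * inv_S"
      using n16' M_pos inv_S_ge by (intro mult_left_mono) auto
    ultimately have "M\<^sup>2 * (?m\<^sup>2 * i2 - 2 * ?m * (real n / M) * inv_S + (real n / M)\<^sup>2) \<le>
        M\<^sup>2 * (?m\<^sup>2 * (1 / (M - 8)\<^sup>2) - 2 * ?m * (real n / M) * (1 / M) + (real n / M)\<^sup>2)"
      by (intro mult_left_mono) auto
    also have "\<dots> = ?m\<^sup>2 * (M\<^sup>2 / (M - 8)\<^sup>2) - 2 * ?m * real n + (real n)\<^sup>2"
    proof -
      have "M\<^sup>2 * (m\<^sup>2 * (1 / Y) - 2 * m * (k / M) * (1 / M) + (k / M)\<^sup>2) = m\<^sup>2 * (M\<^sup>2 / Y) - 2 * m * k + k\<^sup>2"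
        for m k Y :: real
        using M_pos by (simp add: power2_eq_square field_simps)
      then show ?thesis .
    qed
    also have "\<dots> = ?m\<^sup>2 * (M\<^sup>2 / (M - 8)\<^sup>2 - 1) + 4"
    proof -
      have "?m\<^sup>2 * X - 2 * ?m * real n + (real n)\<^sup>2 = ?m\<^sup>2 * (X - 1) + 4" for X
        by (simp add: power2_eq_square algebra_simps)
      then show ?thesis .
    qed
    \<comment> \<open>The numerator is \<open>16 * M - 64\<close>, and
      \<open>M - 8 \<ge> M / 2\<close> bounds the denominator below by
      \<open>M^2 / 4\<close>.\<close>
    also have "M\<^sup>2 / (M - 8)\<^sup>2 - 1 \<le> 64 / M"
    proof -
      have "M\<^sup>2 \<le> (2 * (M - 8))\<^sup>2" using M_pos by (intro power_mono) auto
      then have "(16 * M - 64) * M \<le> 64 * (M - 8)\<^sup>2"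
        using M_pos by (simp add: power2_eq_square algebra_simps)
      then have "(16 * M - 64) / (M - 8)\<^sup>2 \<le> 64 / M"
        using M_pos M8 by (simp add: divide_le_eq le_divide_eq)
      moreover have "M\<^sup>2 / (M - 8)\<^sup>2 - 1 = (16 * M - 64) / (M - 8)\<^sup>2"
        using M8 by (simp add: divide_simps) (simp add: power2_eq_square algebra_simps)
      ultimately show ?thesis by simp
    qed
    also have "?m\<^sup>2 * (64 / M) \<le> (real n)\<^sup>2 * (64 / M)"
      using n16' M_pos by (intro mult_right_mono power_mono) auto
    also have "\<dots> \<le> (real n)\<^sup>2 * (64 / real n)"
      using n16' M_ge by (intro mult_left_mono divide_left_mono) auto
    also have "\<dots> = 64 * real n" by (simp add: power2_eq_square)
    finally show ?thesis using n16' by simp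
  qed
  ultimately show ?thesis by (intro that) auto
qed

end

subsection \<open>Estimated variance\<close>

text \<open>Both bounds are \<open>ln z \<le> z - 1\<close>, at \<open>z = q / p\<close> and at
  \<open>z = p / q\<close>.\<close>

lemma ln_ratio_bounds:
  fixes p q :: real
  assumes "0 < p" "0 < q"
  shows "0 \<le> ln (p / q) + q / p - 1" "ln (p / q) + q / p - 1 \<le> (p - q)\<^sup>2 / (p * q)"
proof -
  have "ln (q / p) \<le> q / p - 1" "ln (p / q) \<le> p / q - 1"
    using assms by (auto intro!: ln_le_minus_one)
  moreover have "ln (q / p) = - ln (p / q)"
    using assms by (simp add: ln_div)
  moreover have "p / q - 1 + q / p - 1 = (p - q)\<^sup>2 / (p * q)"
    using assms by (simp add: power2_eq_square field_simps)
  ultimately show "0 \<le> ln (p / q) + q / p - 1" "ln (p / q) + q / p - 1 \<le> (p - q)\<^sup>2 / (p * q)"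
    by linarith+
qed

text \<open>The left-hand side compares the divergence for the estimated variance \<open>r + u\<close> with the one for the
  variance \<open>r + d\<close>. In both arguments the difference is of second order, so that fluctuations of
  \<open>u\<close> of order \<open>n powr (- 1 / 2)\<close>, which may exceed \<open>d\<close>, are harmless.\<close>

lemma divergence_perturbation:
  fixes r u d l :: real
  assumes r: "0 < r" and u: "0 \<le> u" and d: "0 \<le> d"
  shows "\<bar>(ln (1 + u / r) + (l - u) / (r + u)) - (ln (1 + d / r) + (l - d) / (r + d))\<bar>
    \<le> ((u - d)\<^sup>2 + \<bar>l - d\<bar> * \<bar>u - d\<bar>) / r\<^sup>2"
proof -
  define p q where "p = r + u" and "q = r + d"
  have p: "r \<le> p" "0 < p" and q: "r \<le> q" "0 < q" using assms by (auto simp: p_def q_def)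
  have pq: "r\<^sup>2 \<le> p * q" using p q r by (simp add: power2_eq_square mult_mono)
  have r2: "0 < r\<^sup>2" using r by simp
  have "1 + u / r = p / r" "1 + d / r = q / r" using r by (auto simp: p_def q_def field_simps)
  then have ln: "ln (1 + u / r) - ln (1 + d / r) = ln (p / q)"
    using p q r by (simp add: ln_div)
  have ud: "u = p - r" "d = q - r" by (auto simp: p_def q_def)
  \<comment> \<open>Write \<open>l - u = (l - d) + (q - p)\<close>. The part
    \<open>q / p - 1\<close> joins the logarithm to form the quadratically small quantity of
    \<open>ln_ratio_bounds\<close>.\<close>
  have "(l - u) / (r + u) - (l - d) / (r + d) = q / p - 1 + (l - d) * (1 / p - 1 / q)"
    unfolding ud using p q by (simp add: field_simps)
  then have "(ln (1 + u / r) + (l - u) / (r + u)) - (ln (1 + d / r) + (l - d) / (r + d)) =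
      (ln (p / q) + q / p - 1) + (l - d) * (1 / p - 1 / q)"
    using ln by linarith
  moreover have "0 \<le> ln (p / q) + q / p - 1" "ln (p / q) + q / p - 1 \<le> (u - d)\<^sup>2 / r\<^sup>2"
  proof -
    show "0 \<le> ln (p / q) + q / p - 1" by (rule ln_ratio_bounds(1)) fact+
    have "(p - q)\<^sup>2 / (p * q) \<le> (p - q)\<^sup>2 / r\<^sup>2"
      using pq r2 p q by (intro divide_left_mono) auto
    then show "ln (p / q) + q / p - 1 \<le> (u - d)\<^sup>2 / r\<^sup>2"
      using ln_ratio_bounds(2)[of p q] p q by (simp add: p_def q_def)
  qed
  moreover have "\<bar>(l - d) * (1 / p - 1 / q)\<bar> \<le> \<bar>l - d\<bar> * \<bar>u - d\<bar> / r\<^sup>2"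
  proof -
    have "1 / p - 1 / q = (d - u) / (p * q)" unfolding ud using p q by (simp add: field_simps)
    then have "\<bar>1 / p - 1 / q\<bar> = \<bar>u - d\<bar> / (p * q)"
      using p q by (simp add: abs_divide abs_mult abs_minus_commute)
    also have "\<dots> \<le> \<bar>u - d\<bar> / r\<^sup>2"
      using pq r2 p q by (intro divide_left_mono) auto
    finally show ?thesis
      unfolding abs_mult times_divide_eq_right[symmetric] by (intro mult_left_mono) auto
  qed
  ultimately show ?thesis unfolding add_divide_distrib by linarith
qed

section \<open>Pointwise control of the estimated variance and of the loss\<close>

context gaussian_shift
begin

text \<open>The estimated excess variance: \<open>c_hat n r x * r = r + u x\<close>. Its
  deterministic counterpart is \<open>D\<close>.\<close>

definition u :: "(nat \<Rightarrow> real) \<Rightarrow> real" where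
  "u x = U_hat_pos n x / real n"

lemma measurable_u [measurable]: "u \<in> borel_measurable (lborel_n n)"
  unfolding u_def U_hat_pos_def by measurable

lemma measurable_dev [measurable]: "dev \<in> borel_measurable (lborel_n n)"
  unfolding dev_def by measurable

lemma u_bounds: "0 \<le> u x" "u x \<le> 1"
  using n16' by (auto simp: u_def U_hat_pos_def)

lemma one_minus_shrinkage: "\<bar>1 - (real n - 2) / S x\<bar> \<le> 1 + \<bar>dev x\<bar>" "\<bar>(real n - 2) / S x\<bar> \<le> 1 + \<bar>dev x\<bar>"
proof -
  have "0 \<le> (real n - 2) / S x" using n16' by simp
  moreover have "0 \<le> real n / M" "real n / M \<le> 1" using M_pos M_ge by auto
  ultimately show "\<bar>1 - (real n - 2) / S x\<bar> \<le> 1 + \<bar>dev x\<bar>" "\<bar>(real n - 2) / S x\<bar> \<le> 1 + \<bar>dev x\<bar>"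
    unfolding dev_def by linarith+
qed

lemma u_minus_D: "\<bar>u x - D\<bar> \<le> 2 * \<bar>dev x\<bar> + 2 / real n" "\<bar>u x - D\<bar> \<le> 1"
proof -
  let ?b = "(real n - 2) / S x"
  have n0: "real n > 0" using n16' by simp
  have "(N - m\<^sup>2 / s) / N = 1 - m * (m / s) / N" if "0 < N" for N m s :: real
    using that by (simp add: diff_divide_distrib power2_eq_square)
  then have "u x = max (1 - (real n - 2) * ?b / real n) 0"
    unfolding u_def U_hat_pos_def max_divide_distrib_right using n0 by simp
  \<comment> \<open>Since \<open>D \<ge> 0\<close>, taking the positive part cannot increase the
    distance to \<open>D\<close>.\<close>
  then have "\<bar>u x - D\<bar> \<le> \<bar>1 - (real n - 2) * ?b / real n - D\<bar>"
    using D_bounds by auto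
  also have "1 - (real n - 2) * ?b / real n - D = 2 * ?b / real n - dev x"
  proof -
    have "1 - (N - 2) * b / N - (1 - y) = 2 * b / N - (b - y)" if "0 < N" for N b y :: real
      using that by (simp add: field_simps)
    from this[OF n0] show ?thesis unfolding D_eq dev_def .
  qed
  also have "\<bar>\<dots>\<bar> \<le> 2 * \<bar>?b\<bar> / real n + \<bar>dev x\<bar>"
  proof -
    have "\<bar>2 * b / N - y\<bar> \<le> 2 * \<bar>b\<bar> / N + \<bar>y\<bar>" if "0 < N" for N b y :: real
      using that by (intro order_trans[OF abs_triangle_ineq4]) (simp add: abs_mult)
    from this[OF n0] show ?thesis .
  qed
  also have "2 * \<bar>?b\<bar> / real n \<le> 2 * (1 + \<bar>dev x\<bar>) / real n"
    using one_minus_shrinkage(2)[of x] n0 by (intro divide_right_mono mult_left_mono) auto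
  also have "\<dots> = 2 / real n + \<bar>dev x\<bar> * (2 / real n)" by (simp add: add_divide_distrib)
  also have "\<bar>dev x\<bar> * (2 / real n) \<le> \<bar>dev x\<bar>"
    using n16' by (intro mult_left_le) auto
  finally show "\<bar>u x - D\<bar> \<le> 2 * \<bar>dev x\<bar> + 2 / real n" by simp
  show "\<bar>u x - D\<bar> \<le> 1" using u_bounds[of x] D_bounds by (simp add: abs_le_iff)
qed

text \<open>An exact splitting: the chi-square fluctuation multiplied by the shrinkage factor, plus
  \<kappa> times the fluctuation of the shrinkage.\<close>

lemma loss_minus_D:
  assumes "0 < S x"
  shows "\<bar>loss x - real n * D\<bar> \<le> (1 + \<bar>dev x\<bar>) * \<bar>Q x - real n + 2\<bar> + (vnorm n \<theta>)\<^sup>2 * \<bar>dev x\<bar>"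
proof -
  let ?b = "(real n - 2) / S x"
  have "loss x - real n * D = (1 - ?b) * (Q x - real n + 2) + (vnorm n \<theta>)\<^sup>2 * dev x"
  proof -
    have "q - (N - 2) + b * (k - q + (N - 2)) - N * (k / M) = (1 - b) * (q - N + 2) + k * (b - N / M)"
      for q N b k :: real
      by (simp add: algebra_simps)
    then show ?thesis unfolding loss_eq[OF assms] dev_def D_def .
  qed
  also have "\<bar>\<dots>\<bar> \<le> \<bar>1 - ?b\<bar> * \<bar>Q x - real n + 2\<bar> + (vnorm n \<theta>)\<^sup>2 * \<bar>dev x\<bar>"
    by (rule order_trans[OF abs_triangle_ineq]) (simp add: abs_mult)
  also have "\<dots> \<le> (1 + \<bar>dev x\<bar>) * \<bar>Q x - real n + 2\<bar> + (vnorm n \<theta>)\<^sup>2 * \<bar>dev x\<bar>"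
    by (intro add_right_mono mult_right_mono one_minus_shrinkage) auto
  finally show ?thesis .
qed

text \<open>A majorant built only from squares of known expectation. The coefficients of
  \<open>(dev x)^2\<close> are admissible because the mean of that square is at most
  \<open>68 * n / M^2\<close>.\<close>

definition err :: "(nat \<Rightarrow> real) \<Rightarrow> real" where
  "err x = 10 + 5 * (Q x - real n + 2)\<^sup>2 / real n + (10 * M + (M / real n)\<^sup>2) * (dev x)\<^sup>2"

text \<open>Products are separated by \<open>2 * q * e \<le> q^2 / N + N * e^2\<close>, the weight
  for which both halves have bounded expectation: \<open>q^2\<close> averages to about
  \<open>2 * N\<close>, and \<open>e^2\<close> to at most \<open>68 * N / M^2\<close>.\<close>

lemma err_bound:
  assumes "0 < S x"
  shows "real n * (u x - D)\<^sup>2 + \<bar>loss x - real n * D\<bar> * \<bar>u x - D\<bar> \<le> err x"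
proof -
  define e q N k where "e = \<bar>dev x\<bar>" and "q = \<bar>Q x - real n + 2\<bar>" and "N = real n"
    and "k = (vnorm n \<theta>)\<^sup>2"
  define w where "w = \<bar>u x - D\<bar>"
  have N: "16 \<le> N" and nonneg: "0 \<le> e" "0 \<le> q" "0 \<le> k" "0 \<le> w"
    using n16' by (auto simp: N_def e_def q_def k_def w_def)
  have w: "w \<le> 2 * e + 2 / N" "w \<le> 1"
    using u_minus_D[of x] by (auto simp: w_def e_def N_def)
  have iN: "1 / N \<le> 1" using N by simp
  have "N * w\<^sup>2 \<le> N * (2 * e + 2 / N)\<^sup>2"
    using N nonneg w by (intro mult_left_mono power_mono) auto
  also have "\<dots> \<le> N * (8 * e\<^sup>2 + 8 * (1 / N)\<^sup>2)"
  proof (intro mult_left_mono)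
    have "(2 * e + 2 * y)\<^sup>2 \<le> 8 * e\<^sup>2 + 8 * y\<^sup>2" for y :: real
      using zero_le_power2[of "e - y"] by (simp add: power2_eq_square algebra_simps)
    from this[of "1 / N"] show "(2 * e + 2 / N)\<^sup>2 \<le> 8 * e\<^sup>2 + 8 * (1 / N)\<^sup>2" by simp
  qed (use N in simp)
  also have "\<dots> = 8 * N * e\<^sup>2 + 8 * (1 / N)"
    using N by (simp add: power2_eq_square field_simps)
  also have "\<dots> \<le> 8 * N * e\<^sup>2 + 8"
    using iN by simp
  finally have 1: "N * w\<^sup>2 \<le> 8 * N * e\<^sup>2 + 8" .
  have qe: "2 * (q * e) \<le> q\<^sup>2 / N + N * e\<^sup>2"
  proof -
    have "0 \<le> (q - N * e)\<^sup>2 / N" using N by simp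
    also have "\<dots> = q\<^sup>2 / N + N * e\<^sup>2 - 2 * (q * e)"
      using N by (simp add: power2_eq_square field_simps)
    finally show ?thesis by simp
  qed
  have q1: "2 * q / N \<le> q\<^sup>2 / N + 1 / N"
  proof -
    have "2 * q \<le> q\<^sup>2 + 1" using zero_le_power2[of "q - 1"] by (simp add: power2_eq_square algebra_simps)
    then have "2 * q / N \<le> (q\<^sup>2 + 1) / N" using N by (intro divide_right_mono) auto
    then show ?thesis by (simp add: add_divide_distrib)
  qed
  have "(1 + e) * q * w = q * w + q * e * w" by (simp add: algebra_simps)
  \<comment> \<open>The cubic term \<open>q * e * w\<close> is reduced to second order by
    \<open>w \<le> 1\<close>; the term \<open>q * w\<close> uses the finer bound on
    \<open>w\<close>.\<close>
  also have "\<dots> \<le> q * (2 * e + 2 / N) + q * e * 1"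
    using nonneg w by (intro add_mono mult_left_mono) auto
  also have "\<dots> = 3 * (q * e) + 2 * q / N" by (simp add: algebra_simps)
  also have "\<dots> \<le> 3 / 2 * (q\<^sup>2 / N + N * e\<^sup>2) + (q\<^sup>2 / N + 1 / N)"
    using qe q1 by argo
  also have "\<dots> \<le> 5 * (q\<^sup>2 / N) + 2 * N * e\<^sup>2 + 1"
  proof -
    have "0 \<le> q\<^sup>2 / N" "0 \<le> N * e\<^sup>2" using N by auto
    moreover have "3 / 2 * (A + B) + (A + y) \<le> 5 * A + 2 * B + 1" if "0 \<le> A" "0 \<le> B" "y \<le> 1" for A B y :: real
      using that by argo
    ultimately show ?thesis using iN by (simp only: mult.assoc)
  qed
  finally have 2: "(1 + e) * q * w \<le> 5 * (q\<^sup>2 / N) + 2 * N * e\<^sup>2 + 1" .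
  have "k * e * w \<le> k * e * (2 * e + 2 / N)"
    using nonneg w by (intro mult_left_mono) auto
  also have "\<dots> = 2 * k * e\<^sup>2 + 2 * (k / N * e)"
    by (simp add: power2_eq_square algebra_simps)
  \<comment> \<open>Unit weights here produce the coefficient \<open>(M / n)^2\<close> of
    \<open>err\<close>.\<close>
  also have "2 * (k / N * e) \<le> (k / N * e)\<^sup>2 + 1"
    using zero_le_power2[of "k / N * e - 1"] by (simp add: power2_eq_square algebra_simps)
  finally have 3: "k * e * w \<le> 2 * k * e\<^sup>2 + (k / N)\<^sup>2 * e\<^sup>2 + 1"
    by (simp add: power_mult_distrib power_divide)
  have M: "M = N + k" by (simp add: M_def N_def k_def)
  have "(k / N)\<^sup>2 * e\<^sup>2 \<le> (M / N)\<^sup>2 * e\<^sup>2"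
    using N nonneg M by (intro mult_right_mono power_mono divide_right_mono) auto
  moreover have "0 \<le> k * e\<^sup>2" using nonneg by simp
  ultimately have "8 * N * e\<^sup>2 + 8 + (5 * (q\<^sup>2 / N) + 2 * N * e\<^sup>2 + 1) + (2 * k * e\<^sup>2 + (k / N)\<^sup>2 * e\<^sup>2 + 1)
      \<le> 10 + 5 * (q\<^sup>2 / N) + (10 * M + (M / N)\<^sup>2) * e\<^sup>2"
    unfolding M by (simp add: algebra_simps)
  also have "\<dots> = err x" by (simp add: err_def e_def q_def N_def)
  finally have 4: "8 * N * e\<^sup>2 + 8 + (5 * (q\<^sup>2 / N) + 2 * N * e\<^sup>2 + 1) + (2 * k * e\<^sup>2 + (k / N)\<^sup>2 * e\<^sup>2 + 1) \<le> err x" .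
  have "\<bar>loss x - real n * D\<bar> * w \<le> ((1 + e) * q + k * e) * w"
    using loss_minus_D[OF assms] nonneg
    by (intro mult_right_mono) (auto simp: e_def q_def k_def)
  also have "\<dots> = (1 + e) * q * w + k * e * w" by (simp add: algebra_simps)
  finally have "\<bar>loss x - real n * D\<bar> * w \<le> (1 + e) * q * w + k * e * w" .
  moreover have "real n * (u x - D)\<^sup>2 = N * w\<^sup>2" by (simp add: N_def w_def)
  ultimately show ?thesis using 1 2 3 4 unfolding w_def[symmetric] by linarith
qed

lemma expectation_err:
  obtains c where "has_bochner_integral law err c" "c \<le> 800"
proof -
  obtain c2 where c2: "has_bochner_integral law (\<lambda>x. (dev x)\<^sup>2) c2" "M\<^sup>2 * c2 \<le> 68 * real n"
    by (rule expectation_dev_sq)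
  have "has_bochner_integral law (\<lambda>x. (Q x - real n)\<^sup>2 + 4 * (Q x - real n) + 4) (2 * real n + 4 * (real n - real n) + 4)"
    by (intro has_bochner_integral_add has_bochner_integral_mult_right has_bochner_integral_diff
        expectation_sq_dist_deviation expectation_Q)
      (simp_all add: has_bochner_integral_iff prob_space)
  moreover have "(Q x - real n)\<^sup>2 + 4 * (Q x - real n) + 4 = (Q x - real n + 2)\<^sup>2" for x
    by (simp add: power2_eq_square algebra_simps)
  ultimately have q: "has_bochner_integral law (\<lambda>x. (Q x - real n + 2)\<^sup>2) (2 * real n + 4)" by simp
  have "has_bochner_integral law err
     (10 + 5 * (2 * real n + 4) / real n + (10 * M + (M / real n)\<^sup>2) * c2)"
    unfolding err_def[abs_def]
    by (intro has_bochner_integral_add has_bochner_integral_mult_right has_bochner_integral_divide q c2(1))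
      (simp add: has_bochner_integral_iff prob_space)
  \<comment> \<open>The summands contribute 10, at most 15 and at most 685.\<close>
  moreover have "10 + 5 * (2 * real n + 4) / real n + (10 * M + (M / real n)\<^sup>2) * c2 \<le> 800"
  proof -
    have c2n: "c2 \<le> 68 * real n / M\<^sup>2" using c2(2) M_pos by (simp add: field_simps)
    have "(10 * M + (M / real n)\<^sup>2) * c2 \<le> (10 * M + (M / real n)\<^sup>2) * (68 * real n / M\<^sup>2)"
      using M_pos by (intro mult_left_mono c2n) auto
    also have "\<dots> = 680 * (real n / M) + 68 / real n"
      using M_pos n16' by (simp add: power2_eq_square field_simps)
    also have "\<dots> \<le> 680 * 1 + 68 / 16"
      using M_pos M_ge n16' by (intro add_mono mult_left_mono divide_left_mono) auto
    finally have "(10 * M + (M / real n)\<^sup>2) * c2 \<le> 685" by simp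
    moreover have "5 * (2 * real n + 4) / real n \<le> 15" using n16' by (simp add: divide_le_eq)
    ultimately show ?thesis by linarith
  qed
  ultimately show ?thesis by (rule that)
qed

section \<open>Risks of Gaussian densities centred at the James-Stein estimator\<close>

lemma predictive_risk_eq:
  assumes r: "0 < r" and v: "\<And>x. 0 < v x"
  shows "predictive_risk n r \<theta> (\<lambda>x. normal_density_n n (\<mu> x) (v x)) =
    (\<integral>x. 1 / 2 * (real n * ln (v x / r) - real n + real n * r / v x + (vnorm n (\<lambda>i. \<mu> x i - \<theta> i))\<^sup>2 / v x) \<partial>law)"
  unfolding predictive_risk_def by (simp only: kl_normal_density_n[OF r v])

lemma predictive_risk_james_stein:
  assumes r: "0 < r" and v: "0 < v"
  shows "predictive_risk n r \<theta> (\<lambda>x. normal_density_n n (james_stein n x) v) =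
    1 / 2 * (real n * ln (v / r) - real n + real n * r / v + R / v)"
proof -
  have c: "has_bochner_integral law (\<lambda>x. c) c" for c :: real
    by (simp add: has_bochner_integral_iff prob_space)
  show ?thesis
    unfolding predictive_risk_eq[OF r v]
    by (intro has_bochner_integral_integral_eq has_bochner_integral_mult_right has_bochner_integral_add
        has_bochner_integral_divide expectation_loss c)
qed

text \<open>\<open>G t\<close> is half the bracket of the divergence at variance
  \<open>r + t\<close>. For the constant \<open>D\<close> it is affine in the loss and has an
  explicit mean. Replacing \<open>u\<close> by \<open>D\<close> costs at most 800 / (2 r^2), and
  replacing \<open>R\<close> by \<open>n D\<close> at most 4 / (2 r).\<close>

lemma predictive_risk_g_james_stein:
  assumes r: "0 < r"
  shows "\<bar>predictive_risk n r \<theta> (g_james_stein n r) - real n / 2 * ln (1 + D / r)\<bar> \<le> 400 / r\<^sup>2 + 2 / r"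
proof -
  define G where "G t x = real n / 2 * (ln (1 + t / r) + (loss x / real n - t) / (r + t))" for t x
  have n0: "real n > 0" using n16' by simp
  have c_hat: "c_hat n r x * r = r + u x" for x
    using r n0 by (simp add: c_hat_def u_def field_simps)
  have ru: "0 < r + u x" for x using u_bounds(1)[of x] r by simp
  have "predictive_risk n r \<theta> (g_james_stein n r) =
      (\<integral>x. 1 / 2 * (real n * ln ((r + u x) / r) - real n + real n * r / (r + u x) + loss x / (r + u x)) \<partial>law)"
    unfolding g_james_stein_def[abs_def] c_hat using r ru by (rule predictive_risk_eq)
  also have "\<dots> = (\<integral>x. G (u x) x \<partial>law)"
  proof (intro Bochner_Integration.integral_cong refl)
    fix x
    have "(r + u x) / r = 1 + u x / r" using r by (simp add: field_simps)
    moreover have "- real n + real n * r / (r + t) + l / (r + t) = real n * ((l / real n - t) / (r + t))"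
      if "0 < r + t" for t l :: real
    proof -
      have "- N + N * r / s + l / s = N * ((l / N - (s - r)) / s)" if "0 < s" "0 < N" for s N :: real
        using that by (simp add: field_simps)
      from this[OF that n0] show ?thesis by simp
    qed
    moreover have "1 / 2 * (N * L - N + A + B) = N / 2 * (L + X)" if "- N + A + B = N * X" for N L A B X :: real
    proof -
      have "1 / 2 * (N * L - N + A + B) = 1 / 2 * (N * L + (- N + A + B))" by simp
      then show ?thesis unfolding that by (simp add: algebra_simps)
    qed
    ultimately show "1 / 2 * (real n * ln ((r + u x) / r) - real n + real n * r / (r + u x) + loss x / (r + u x)) =
        G (u x) x"
      using ru[of x] unfolding G_def by presburger
  qed
  finally have risk: "predictive_risk n r \<theta> (g_james_stein n r) = (\<integral>x. G (u x) x \<partial>law)" .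
  obtain c where c: "has_bochner_integral law err c" "c \<le> 800" by (rule expectation_err)
  have GD: "has_bochner_integral law (G D) (real n / 2 * (ln (1 + D / r) + (R / real n - D) / (r + D)))"
    unfolding G_def[abs_def]
    by (intro has_bochner_integral_mult_right has_bochner_integral_add has_bochner_integral_divide
        has_bochner_integral_diff expectation_loss)
      (simp_all add: has_bochner_integral_iff prob_space)
  have diff: "AE x in law. \<bar>G (u x) x - G D x\<bar> \<le> err x / (2 * r\<^sup>2)"
    using AE_S_pos
  proof eventually_elim
    case (elim x)
    have "\<bar>G (u x) x - G D x\<bar> = real n / 2 * \<bar>(ln (1 + u x / r) + (loss x / real n - u x) / (r + u x)) -
        (ln (1 + D / r) + (loss x / real n - D) / (r + D))\<bar>"
      unfolding G_def right_diff_distrib[symmetric] abs_mult using n0 by simp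
    also have "\<dots> \<le> real n / 2 * (((u x - D)\<^sup>2 + \<bar>loss x / real n - D\<bar> * \<bar>u x - D\<bar>) / r\<^sup>2)"
      using n0 by (intro mult_left_mono divergence_perturbation r u_bounds D_bounds) auto
    also have "\<bar>loss x / real n - D\<bar> = \<bar>loss x - real n * D\<bar> / real n"
    proof -
      have "loss x / real n - D = (loss x - real n * D) / real n"
        using n0 by (simp add: field_simps)
      then show ?thesis using n0 by simp
    qed
    also have "real n / 2 * (((u x - D)\<^sup>2 + \<bar>loss x - real n * D\<bar> / real n * \<bar>u x - D\<bar>) / r\<^sup>2) =
        (real n * (u x - D)\<^sup>2 + \<bar>loss x - real n * D\<bar> * \<bar>u x - D\<bar>) / (2 * r\<^sup>2)"
      using n0 r by (simp add: field_simps)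
    also have "\<dots> \<le> err x / (2 * r\<^sup>2)"
      using r by (intro divide_right_mono err_bound elim) auto
    finally show ?case .
  qed
  have "integrable law (\<lambda>x. err x / (2 * r\<^sup>2))"
    using c(1) by (auto simp: has_bochner_integral_iff)
  then have int: "integrable law (\<lambda>x. G (u x) x - G D x)"
  proof (rule Bochner_Integration.integrable_bound)
    show "(\<lambda>x. G (u x) x - G D x) \<in> borel_measurable law"
      unfolding G_def by measurable
    show "AE x in law. norm (G (u x) x - G D x) \<le> norm (err x / (2 * r\<^sup>2))"
      using diff
    proof eventually_elim
      case (elim x)
      then show ?case unfolding real_norm_def by (rule order_trans) (rule abs_ge_self)
    qed
  qed
  have "\<bar>\<integral>x. G (u x) x - G D x \<partial>law\<bar> \<le> (\<integral>x. \<bar>G (u x) x - G D x\<bar> \<partial>law)"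
    by (rule integral_abs_bound)
  also have "\<dots> \<le> (\<integral>x. err x / (2 * r\<^sup>2) \<partial>law)"
    using diff int c(1) by (intro integral_mono_AE) (auto simp: has_bochner_integral_iff)
  also have "\<dots> = c / (2 * r\<^sup>2)"
    using c(1) by (simp add: has_bochner_integral_iff)
  also have "\<dots> \<le> 800 / (2 * r\<^sup>2)"
    using c(2) r by (intro divide_right_mono) auto
  finally have 1: "\<bar>\<integral>x. G (u x) x - G D x \<partial>law\<bar> \<le> 400 / r\<^sup>2" by simp
  have "integrable law (\<lambda>x. (G (u x) x - G D x) + G D x)"
    using int GD by (intro Bochner_Integration.integrable_add) (auto simp: has_bochner_integral_iff)
  \<comment> \<open>Integrability of the actual risk integrand is obtained only through its
    difference from \<open>G D\<close>; without it, linearity of the Bochner integral would not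
    apply.\<close>
  then have "integrable law (\<lambda>x. G (u x) x)" by simp
  then have 2: "(\<integral>x. G (u x) x - G D x \<partial>law) =
      (\<integral>x. G (u x) x \<partial>law) - real n / 2 * (ln (1 + D / r) + (R / real n - D) / (r + D))"
    using GD by (simp add: has_bochner_integral_iff)
  have "\<bar>(R - real n * D) / (2 * (r + D))\<bar> \<le> 4 / (2 * (r + D))"
    using R_close r D_bounds by (simp add: divide_right_mono)
  also have "\<dots> \<le> 4 / (2 * r)"
    using r D_bounds by (intro divide_left_mono) auto
  finally have 3: "\<bar>(R - real n * D) / (2 * (r + D))\<bar> \<le> 2 / r" by simp
  have "real n / 2 * (ln (1 + D / r) + (R / real n - D) / (r + D)) =
      real n / 2 * ln (1 + D / r) + (R - real n * D) / (2 * (r + D))"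
  proof -
    have "N / 2 * (L + (x / N - y) / s) = N / 2 * L + (x - N * y) / (2 * s)" if "0 < N" "0 < s" for N L x y s :: real
      using that by (simp add: field_simps)
    then show ?thesis using n0 r D_bounds by simp
  qed
  then show ?thesis
    unfolding risk using 1 2 3 by linarith
qed

end

subsection \<open>Asymptotics\<close>

lemma asymp_equiv_of_bounded_diff:
  fixes f g :: "nat \<Rightarrow> real"
  assumes lim: "filterlim g at_top sequentially"
    and bound: "\<forall>\<^sub>F n in sequentially. \<bar>f n - g n\<bar> \<le> K"
  shows "f \<sim>[at_top] g"
proof (rule smallo_imp_asymp_equiv)
  have "(\<lambda>n. f n - g n) \<in> O(\<lambda>_. 1)"
    using bound by (intro bigoI[of _ K]) simp
  moreover have "(\<lambda>_. 1) \<in> o(g)"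
  proof (rule smalloI_tendsto)
    show "((\<lambda>n. 1 / g n) \<longlongrightarrow> 0) sequentially"
      using tendsto_inverse_0_at_top[OF lim] by (simp add: inverse_eq_divide)
    show "\<forall>\<^sub>F n in sequentially. g n \<noteq> 0"
      using lim[unfolded filterlim_at_top_dense, rule_format, of 0] by eventually_elim simp
  qed
  ultimately show "(\<lambda>n. f n - g n) \<in> o(g)"
    by (rule landau_o.big_small_trans)
qed

text \<open>For positive terms this is half the harmonic mean, hence at least half the minimum.
  Applied to n and \<parallel>\<theta>\<parallel>^2 it gives \<open>n D\<close> \<rightarrow>
  \<infinity>.\<close>

lemma filterlim_sum_recip_at_top:
  fixes f g :: "nat \<Rightarrow> real"
  assumes f: "filterlim f at_top sequentially" and g: "filterlim g at_top sequentially"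
  shows "filterlim (\<lambda>n. f n * g n / (f n + g n)) at_top sequentially"
  unfolding filterlim_at_top_dense
proof
  fix Z :: real
  define Y where "Y = 2 * max Z 1"
  have Y: "Y > 0" "Y \<ge> 2 * Z" by (auto simp: Y_def)
  have "\<forall>\<^sub>F n in sequentially. f n > Y" "\<forall>\<^sub>F n in sequentially. g n > Y"
    using f g by (auto simp: filterlim_at_top_dense)
  then show "\<forall>\<^sub>F n in sequentially. f n * g n / (f n + g n) > Z"
  proof eventually_elim
    case (elim n)
    have "Y * (f n + g n) < 2 * (f n * g n)"
    proof -
      have "Y * g n < f n * g n" "Y * f n < g n * f n"
        using elim Y by (auto intro!: mult_strict_right_mono)
      then show ?thesis by (simp add: algebra_simps)
    qed
    moreover have "Z * (f n + g n) \<le> Y / 2 * (f n + g n)"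
      using elim Y by (intro mult_right_mono) auto
    ultimately have "Z * (f n + g n) < f n * g n" by simp
    then show ?case using elim Y by (simp add: less_divide_eq)
  qed
qed

text \<open>A lower bound linear in \<open>d\<close>, so that the target of [d] diverges together
  with \<open>n D\<close>. It is \<open>ln z \<le> z - 1\<close> at
  \<open>z = r / (r + d)\<close>.\<close>

lemma ln_one_plus_ge:
  fixes r d :: real
  assumes r: "0 < r" and d: "0 \<le> d" "d \<le> 1"
  shows "d / (r + 1) \<le> ln (1 + 1 / r * d)"
proof -
  have "d / (r + 1) \<le> d / (r + d)"
    using assms by (intro divide_left_mono) auto
  also have "\<dots> = 1 - r / (r + d)" using assms by (simp add: field_simps)
  also have "\<dots> \<le> - ln (r / (r + d))"
    using assms ln_le_minus_one[of "r / (r + d)"] by simp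
  also have "\<dots> = ln (1 + 1 / r * d)"
  proof -
    have "1 + 1 / r * d = (r + d) / r" using r by (simp add: field_simps)
    then show ?thesis using assms by (simp add: ln_div)
  qed
  finally show ?thesis .
qed

text \<open>Strictness keeps the bracket of [c] away from 0 even if a_n \<rightarrow> 0; equality in
  \<open>ln z \<le> z - 1\<close> occurs only at \<open>z = 1\<close>.\<close>

lemma ln_one_plus_inverse_gt:
  fixes r :: real
  assumes r: "0 < r"
  shows "1 / (1 + r) < ln (1 + 1 / r)"
proof -
  have "ln (r / (1 + r)) < r / (1 + r) - 1"
  proof -
    have "0 < r / (1 + r)" "r / (1 + r) \<noteq> 1" using r by auto
    then show ?thesis
      using ln_eq_minus_one ln_le_minus_one order_less_le by metis
  qed
  also have "\<dots> = - (1 / (1 + r))" using r by (simp add: field_simps)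
  also have "ln (r / (1 + r)) = - ln (1 + 1 / r)"
  proof -
    have "1 + 1 / r = (1 + r) / r" using r by (simp add: field_simps)
    then show ?thesis using r by (simp add: ln_div)
  qed
  finally show ?thesis by simp
qed

lemma mean_square_ratio:
  assumes "n \<ge> 1"
  shows "mean_square \<theta> n / (1 + mean_square \<theta> n) = (vnorm n \<theta>)\<^sup>2 / (real n + (vnorm n \<theta>)\<^sup>2)"
    and "1 / (1 + mean_square \<theta> n) = 1 - (vnorm n \<theta>)\<^sup>2 / (real n + (vnorm n \<theta>)\<^sup>2)"
proof -
  have "real n + (vnorm n \<theta>)\<^sup>2 > 0" "real n > 0"
    using assms by (auto intro: add_pos_nonneg)
  then show "mean_square \<theta> n / (1 + mean_square \<theta> n) = (vnorm n \<theta>)\<^sup>2 / (real n + (vnorm n \<theta>)\<^sup>2)"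
    "1 / (1 + mean_square \<theta> n) = 1 - (vnorm n \<theta>)\<^sup>2 / (real n + (vnorm n \<theta>)\<^sup>2)"
    by (auto simp: mean_square_def field_simps)
qed

lemma predictive_risk_best_invariant:
  assumes r: "0 < r"
  shows "predictive_risk n r \<theta> (\<lambda>x. normal_density_n n x (1 + r)) = real n / 2 * ln (1 + 1 / r)"
proof -
  interpret prob_space "normal_law_n n \<theta> 1" by (rule prob_space_normal_law_n) simp
  have r1: "0 < 1 + r" using r by simp
  have c: "has_bochner_integral (normal_law_n n \<theta> 1) (\<lambda>x. c) c" for c :: real
    by (simp add: has_bochner_integral_iff prob_space)
  have "predictive_risk n r \<theta> (\<lambda>x. normal_density_n n x (1 + r)) =
      1 / 2 * (real n * ln ((1 + r) / r) - real n + real n * r / (1 + r) +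
        (real n * 1 + (vnorm n (\<lambda>i. \<theta> i - \<theta> i))\<^sup>2) / (1 + r))"
    unfolding predictive_risk_def kl_normal_density_n[OF r r1]
    by (intro has_bochner_integral_integral_eq has_bochner_integral_mult_right has_bochner_integral_add
        has_bochner_integral_divide expectation_sq_dist c zero_less_one)
  also have "\<dots> = 1 / 2 * (real n * ln ((1 + r) / r) + (real n * r / (1 + r) + real n / (1 + r) - real n))"
    by (simp add: vnorm_sq)
  \<comment> \<open>The variance \<open>1 + r\<close> exactly matches future noise plus estimation
    error, \<open>n * r + n\<close>.\<close>
  also have "real n * r / (1 + r) + real n / (1 + r) - real n = 0"
  proof -
    have "N * (s - 1) / s + N / s - N = 0" if "0 < s" for N s :: real
      using that by (simp add: field_simps)
    from this[OF r1] show ?thesis by simp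
  qed
  also have "(1 + r) / r = 1 + 1 / r" using r by (simp add: field_simps)
  finally show ?thesis by simp
qed

theorem lemma1p1:
  fixes r :: real and \<theta> :: "nat \<Rightarrow> real" and a :: "nat \<Rightarrow> real"
  defines "a \<equiv> mean_square \<theta>"
  assumes r: "r > 0"
    and \<theta>: "filterlim (\<lambda>n. (vnorm n \<theta>)\<^sup>2) at_top sequentially"
  shows
    "(\<forall>n\<ge>1. predictive_risk n r \<theta> (\<lambda>x. normal_density_n n x (1 + r)) =
        real n / 2 * ln (1 + 1 / r)) \<and>
     (\<lambda>n. predictive_risk n r \<theta> (\<lambda>x. normal_density_n n (james_stein n x) r))
        \<sim>[at_top] (\<lambda>n. real n / (2 * r) * (a n / (1 + a n))) \<and>
     (\<lambda>n. predictive_risk n r \<theta> (\<lambda>x. normal_density_n n (james_stein n x) (1 + r)))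
        \<sim>[at_top] (\<lambda>n. real n / 2 * (ln (1 + 1 / r) - 1 / ((1 + a n) * (1 + r)))) \<and>
     (\<lambda>n. predictive_risk n r \<theta> (g_james_stein n r))
        \<sim>[at_top] (\<lambda>n. real n / 2 * ln (1 + 1 / r * (a n / (1 + a n))))"
proof (intro conjI)
  define d where "d n = a n / (1 + a n)" for n
  have big: "\<forall>\<^sub>F n in sequentially. n \<ge> 16" by (rule eventually_ge_at_top)
  have model: "gaussian_shift n" if "n \<ge> 16" for n
    using that by (rule gaussian_shift.intro)
  have d: "d n = gaussian_shift.D n \<theta>" "1 / (1 + a n) = 1 - d n" "0 \<le> d n" "d n \<le> 1"
    "\<bar>gaussian_shift.R n \<theta> - real n * d n\<bar> \<le> 4" if "n \<ge> 16" for n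
  proof -
    interpret gaussian_shift n \<theta> by (rule model[OF that])
    show 1: "d n = D"
      using that by (simp add: d_def a_def mean_square_ratio D_def M_def)
    show "1 / (1 + a n) = 1 - d n"
      using that mean_square_ratio[of n \<theta>] by (simp only: 1 a_def D_def M_def)
    show "0 \<le> d n" "d n \<le> 1" "\<bar>R - real n * d n\<bar> \<le> 4"
      using D_bounds R_close by (auto simp: 1)
  qed
  have "filterlim (\<lambda>n. real n * (vnorm n \<theta>)\<^sup>2 / (real n + (vnorm n \<theta>)\<^sup>2)) at_top sequentially"
    by (intro filterlim_sum_recip_at_top filterlim_real_sequentially \<theta>)
  moreover have "\<forall>\<^sub>F n in sequentially. real n * (vnorm n \<theta>)\<^sup>2 / (real n + (vnorm n \<theta>)\<^sup>2) = real n * d n"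
    using big by eventually_elim (simp add: d_def a_def mean_square_ratio)
  ultimately have lim: "filterlim (\<lambda>n. real n * d n) at_top sequentially"
    by (rule filterlim_cong[OF refl refl, THEN iffD1, rotated])

  show "\<forall>n\<ge>1. predictive_risk n r \<theta> (\<lambda>x. normal_density_n n x (1 + r)) = real n / 2 * ln (1 + 1 / r)"
    using predictive_risk_best_invariant[OF r] by blast

  show "(\<lambda>n. predictive_risk n r \<theta> (\<lambda>x. normal_density_n n (james_stein n x) r))
        \<sim>[at_top] (\<lambda>n. real n / (2 * r) * (a n / (1 + a n)))"
  proof (rule asymp_equiv_of_bounded_diff)
    have "filterlim (\<lambda>n. 1 / (2 * r) * (real n * d n)) at_top sequentially"
      using r by (intro filterlim_tendsto_pos_mult_at_top[OF tendsto_const _ lim]) auto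
    then show "filterlim (\<lambda>n. real n / (2 * r) * (a n / (1 + a n))) at_top sequentially"
      by (simp add: d_def)
    show "\<forall>\<^sub>F n in sequentially. \<bar>predictive_risk n r \<theta> (\<lambda>x. normal_density_n n (james_stein n x) r) -
        real n / (2 * r) * (a n / (1 + a n))\<bar> \<le> 4 / (2 * r)"
      using big
    proof eventually_elim
      case (elim n)
      interpret gaussian_shift n \<theta> by (rule model[OF elim])
      \<comment> \<open>At variance \<open>r\<close> the logarithm and the trace terms vanish, and
        the risk is \<open>R / (2 * r)\<close>.\<close>
      have "predictive_risk n r \<theta> (\<lambda>x. normal_density_n n (james_stein n x) r) -
          real n / (2 * r) * (a n / (1 + a n)) = (R - real n * d n) / (2 * r)"
        using r by (simp add: predictive_risk_james_stein d_def[symmetric] diff_divide_distrib)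
      moreover have "\<bar>R - real n * d n\<bar> / (2 * r) \<le> 4 / (2 * r)"
        using r by (intro divide_right_mono d(5)[OF elim]) auto
      ultimately show ?case using r by (simp only: abs_divide abs_of_pos mult_pos_pos zero_less_numeral)
    qed
  qed

  show "(\<lambda>n. predictive_risk n r \<theta> (\<lambda>x. normal_density_n n (james_stein n x) (1 + r)))
        \<sim>[at_top] (\<lambda>n. real n / 2 * (ln (1 + 1 / r) - 1 / ((1 + a n) * (1 + r))))"
  proof (rule asymp_equiv_of_bounded_diff)
    \<comment> \<open>The least value of the bracket over \<open>d n\<close> in [0, 1], attained at
      0; it makes the target grow at least linearly in n.\<close>
    define \<delta> where "\<delta> = ln (1 + 1 / r) - 1 / (1 + r)"
    have \<delta>: "\<delta> > 0" using ln_one_plus_inverse_gt[OF r] by (simp add: \<delta>_def)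
    have a: "1 / ((1 + a n) * (1 + r)) = (1 - d n) / (1 + r)" if "n \<ge> 16" for n
      unfolding d(2)[OF that, symmetric] by simp
    have "filterlim (\<lambda>n. \<delta> / 2 * real n) at_top sequentially"
      using \<delta> by (intro filterlim_tendsto_pos_mult_at_top[OF tendsto_const _ filterlim_real_sequentially]) auto
    then show "filterlim (\<lambda>n. real n / 2 * (ln (1 + 1 / r) - 1 / ((1 + a n) * (1 + r)))) at_top sequentially"
    proof (rule filterlim_at_top_mono)
      show "\<forall>\<^sub>F n in sequentially. \<delta> / 2 * real n \<le> real n / 2 * (ln (1 + 1 / r) - 1 / ((1 + a n) * (1 + r)))"
        using big
      proof eventually_elim
        case (elim n)
        have "(1 - d n) / (1 + r) \<le> 1 / (1 + r)"
          using d(3)[OF elim] r by (intro divide_right_mono) auto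
        then have "real n / 2 * \<delta> \<le> real n / 2 * (ln (1 + 1 / r) - (1 - d n) / (1 + r))"
          by (intro mult_left_mono) (auto simp: \<delta>_def)
        then show ?case unfolding a[OF elim] by (simp add: mult.commute)
      qed
    qed
    show "\<forall>\<^sub>F n in sequentially. \<bar>predictive_risk n r \<theta> (\<lambda>x. normal_density_n n (james_stein n x) (1 + r)) -
        real n / 2 * (ln (1 + 1 / r) - 1 / ((1 + a n) * (1 + r)))\<bar> \<le> 4 / (2 * (1 + r))"
      using big
    proof eventually_elim
      case (elim n)
      interpret gaussian_shift n \<theta> by (rule model[OF elim])
      have "(1 + r) / r = 1 + 1 / r" using r by (simp add: field_simps)
      then have "predictive_risk n r \<theta> (\<lambda>x. normal_density_n n (james_stein n x) (1 + r)) =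
          1 / 2 * (real n * ln (1 + 1 / r) - real n + real n * r / (1 + r) + R / (1 + r))"
        using r by (simp add: predictive_risk_james_stein)
      moreover have "1 / 2 * (N * L - N + N * r / (1 + r) + x / (1 + r)) - N / 2 * (L - (1 - y) / (1 + r)) =
          (x - N * y) / (2 * (1 + r))" for N L x y :: real
      proof -
        have "1 / 2 * (N * L - N + N * (s - 1) / s + x / s) - N / 2 * (L - (1 - y) / s) = (x - N * y) / (2 * s)"
          if "s > 0" for s :: real
          using that by (simp add: field_simps)
        from this[of "1 + r"] show ?thesis using r by simp
      qed
      ultimately have "predictive_risk n r \<theta> (\<lambda>x. normal_density_n n (james_stein n x) (1 + r)) -
          real n / 2 * (ln (1 + 1 / r) - 1 / ((1 + a n) * (1 + r))) = (R - real n * d n) / (2 * (1 + r))"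
        unfolding a[OF elim] by (simp only:)
      moreover have "\<bar>R - real n * d n\<bar> / (2 * (1 + r)) \<le> 4 / (2 * (1 + r))"
        using r by (intro divide_right_mono d(5)[OF elim]) auto
      moreover have "0 < 2 * (1 + r)" using r by simp
      ultimately show ?case by (simp only: abs_divide abs_of_pos)
    qed
  qed

  show "(\<lambda>n. predictive_risk n r \<theta> (g_james_stein n r))
        \<sim>[at_top] (\<lambda>n. real n / 2 * ln (1 + 1 / r * (a n / (1 + a n))))"
  proof (rule asymp_equiv_of_bounded_diff)
    have "filterlim (\<lambda>n. 1 / (2 * (r + 1)) * (real n * d n)) at_top sequentially"
      using r by (intro filterlim_tendsto_pos_mult_at_top[OF tendsto_const _ lim]) auto
    then show "filterlim (\<lambda>n. real n / 2 * ln (1 + 1 / r * (a n / (1 + a n)))) at_top sequentially"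
    proof (rule filterlim_at_top_mono)
      show "\<forall>\<^sub>F n in sequentially. 1 / (2 * (r + 1)) * (real n * d n) \<le> real n / 2 * ln (1 + 1 / r * (a n / (1 + a n)))"
        using big
      proof eventually_elim
        case (elim n)
        have "real n / 2 * (d n / (r + 1)) \<le> real n / 2 * ln (1 + 1 / r * d n)"
          using d[OF elim] r by (intro mult_left_mono ln_one_plus_ge) auto
        moreover have "1 / (2 * (r + 1)) * (real n * d n) = real n / 2 * (d n / (r + 1))"
          using r by (simp add: field_simps)
        ultimately show ?case unfolding d_def[symmetric] by (simp only:)
      qed
    qed
    show "\<forall>\<^sub>F n in sequentially. \<bar>predictive_risk n r \<theta> (g_james_stein n r) -
        real n / 2 * ln (1 + 1 / r * (a n / (1 + a n)))\<bar> \<le> 400 / r\<^sup>2 + 2 / r"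
      using big
    proof eventually_elim
      case (elim n)
      interpret gaussian_shift n \<theta> by (rule model[OF elim])
      show ?case
        using predictive_risk_g_james_stein[OF r] d(1)[OF elim] by (simp add: d_def)
    qed
  qed
qed

end
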